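(* Let $n\ge2$ and let $X\in M(n,\mathbb{C})$ with $\|X\|=1$. Then $\lambda_1(T_X)=2$ if and only if $X=U\operatorname{diag}(X_0,O_{n-2})U^*$ for some unitary $U\in U(n)$ and some $X_0\in M(2,\mathbb{C})$ with $\operatorname{Tr}(X_0)=0$.
   Context: $M(n,\mathbb{C})$ is the space of complex $n\times n$ matrices, $X^*$ is the conjugate transpose, $\|X\|=\sqrt{\operatorname{Tr}XX^*}$ is the Frobenius norm, $[X,Y]=XY-YX$, and $O_{n-2}$ is the zero matrix of order $n-2$. $T_X$ is the linear map on $M(n,\mathbb{C})$ given by $T_X(Y)=[X^*,[X,Y]]$; it is self-adjoint and positive semi-definite for $\langle Y,Z\rangle=\operatorname{Tr}(YZ^* )$, and $\lambda_1(T_X)$ is its largest eigenvalue. *)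

theory Defs
  imports "Jordan_Normal_Form.Schur_Decomposition"
begin

definition mat_trace :: "complex mat \<Rightarrow> complex" where
  "mat_trace A = (\<Sum>i<dim_row A. A $$ (i, i))"

(* The trace of X times its adjoint is real and nonnegative, so the real part loses nothing. *)
definition frobenius_norm :: "complex mat \<Rightarrow> real" where
  "frobenius_norm X = sqrt (Re (mat_trace (X * mat_adjoint X)))"

definition commutator :: "complex mat \<Rightarrow> complex mat \<Rightarrow> complex mat" where
  "commutator X Y = X * Y - Y * X"

definition T_map :: "complex mat \<Rightarrow> complex mat \<Rightarrow> complex mat" where
  "T_map X Y = commutator (mat_adjoint X) (commutator X Y)"

definition unitary_mat :: "nat \<Rightarrow> complex mat \<Rightarrow> bool" where
  "unitary_mat n U \<longleftrightarrow> U \<in> carrier_mat n n \<and>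
     U * mat_adjoint U = 1\<^sub>m n \<and> mat_adjoint U * U = 1\<^sub>m n"

(* Eigenvalues of a linear map on the space of complex n x n matrices; the library
   predicate eigenvalue speaks about a matrix acting on vectors. *)
definition map_eigenvalue ::
    "nat \<Rightarrow> (complex mat \<Rightarrow> complex mat) \<Rightarrow> complex \<Rightarrow> bool" where
  "map_eigenvalue n F c \<longleftrightarrow>
     (\<exists>Y \<in> carrier_mat n n. Y \<noteq> 0\<^sub>m n n \<and> F Y = c \<cdot>\<^sub>m Y)"

(* Intended for F self-adjoint and n > 0: then all eigenvalues are real and the set
   below is finite and nonempty, so Max is the largest eigenvalue. *)
definition largest_eigenvalue :: "nat \<Rightarrow> (complex mat \<Rightarrow> complex mat) \<Rightarrow> real" where
  "largest_eigenvalue n F = Max {l. map_eigenvalue n F (complex_of_real l)}"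

end

theory Submission
  imports Defs "Jordan_Normal_Form.Spectral_Radius"
begin

text \<open>
Write \<open>F = X\<^sup>*\<close>. Since \<open>\<langle>T\<^sub>X Y, Y\<rangle> = \<parallel>[X, Y]\<parallel>\<^sup>2\<close>, the statement says which \<open>X\<close> of norm one
attain equality in the Boettcher-Wenzel inequality \<open>\<parallel>[X, Y]\<parallel>\<^sup>2 \<le> 2 \<parallel>X\<parallel>\<^sup>2 \<parallel>Y\<parallel>\<^sup>2\<close>.

The inequality is a bound on variances. Put \<open>S = Y\<^sup>*Y + YY\<^sup>*\<close> with \<open>\<parallel>Y\<parallel> = 1\<close>, so that \<open>S / 2\<close> is a
density matrix. The mixed terms cancel in
\<open>\<parallel>XY - YX\<parallel>\<^sup>2 + \<parallel>FY + YF\<parallel>\<^sup>2 = Tr ((FX + XF) S)\<close>, and by Cauchy-Schwarz the second norm is at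
least \<open>|\<langle>FY + YF, Y\<rangle>| = |Tr (F S)|\<close>. With \<open>X = A + iB\<close> for Hermitian \<open>A\<close>, \<open>B\<close> this gives
\<open>\<parallel>[X, Y]\<parallel>\<^sup>2 \<le> V(A) + V(B)\<close>, where \<open>V(H) = 2 Tr (H\<^sup>2 S) - (Tr (H S))\<^sup>2\<close> is four times the variance of the
observable \<open>H\<close> in the state \<open>S / 2\<close>. In an eigenbasis of \<open>H\<close> this is the variance of a real random
variable whose values are the eigenvalues, and a variance is at most
\<open>(max - min)\<^sup>2 / 4 \<le> (max\<^sup>2 + min\<^sup>2) / 2\<close>; hence \<open>V(H) \<le> 2 \<parallel>H\<parallel>\<^sup>2\<close> (\<open>hermitian_variance\<close>), and
\<open>\<parallel>A\<parallel>\<^sup>2 + \<parallel>B\<parallel>\<^sup>2 = \<parallel>X\<parallel>\<^sup>2\<close> finishes the proof (\<open>boettcher_wenzel\<close>).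

Equality makes every step tight. Then \<open>FY + YF = 0\<close>, and each of \<open>A\<close>, \<open>B\<close>, unless it vanishes, has
spectrum \<open>a, -a, 0, \<dots>, 0\<close> with both \<open>Y\<close> and \<open>Y\<^sup>*\<close> supported on its two-dimensional range. It remains
to see that the ranges of \<open>A\<close> and \<open>B\<close> coincide. If they did not, some nonzero vector of the range of \<open>A\<close>
would be annihilated by \<open>Y\<close> and \<open>Y\<^sup>*\<close>, so \<open>Y\<close> would be a multiple of some \<open>w w\<^sup>*\<close>; then
\<open>FY + YF = 0\<close> forces \<open>A w = 0\<close>, which is impossible on the range of \<open>A\<close>
(\<open>no_common_kernel_2x2\<close>, \<open>extremal_parts_share_corner\<close>). So \<open>X\<close> is a traceless block of order two
(\<open>maximal_commutator_corner\<close>).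

Conversely, for traceless \<open>X\<close>, \<open>Y\<close> of order two the double commutator is a vector triple product:
\<open>T\<^sub>X Y = 2 \<parallel>X\<parallel>\<^sup>2 Y - 2 \<langle>Y, X\<rangle> X\<close>. Any nonzero traceless \<open>Y\<close> orthogonal to \<open>X\<close> is therefore an eigenvector for
the eigenvalue \<open>2 \<parallel>X\<parallel>\<^sup>2\<close>, and both padding with zeros and unitary conjugation preserve this.
\<close>

section \<open>Matrices, adjoints and traces\<close>

declare minus_carrier_mat [simp]

lemma square_mult_carrier [simp]:
  "A \<in> carrier_mat n n \<Longrightarrow> B \<in> carrier_mat n n \<Longrightarrow> A * B \<in> carrier_mat n n"
  by (rule mult_carrier_mat)

lemma mult_mat_entry:
  assumes "A \<in> carrier_mat n m" "B \<in> carrier_mat m p" "i < n" "j < p"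
  shows "(A * B) $$ (i, j) = (\<Sum>k<m. A $$ (i, k) * B $$ (k, j))"
  using assms by (auto simp: scalar_prod_def atLeast0LessThan)

lemma mat_adjoint_carrier [simp]:
  fixes A :: "complex mat"
  assumes "A \<in> carrier_mat n m"
  shows "mat_adjoint A \<in> carrier_mat m n"
  using assms by (auto simp: mat_adjoint_def)

lemma mat_adjoint_dim [simp]:
  "dim_row (mat_adjoint A) = dim_col A" "dim_col (mat_adjoint A) = dim_row A"
  by (auto simp: mat_adjoint_def)

lemma mat_adjoint_entry:
  fixes A :: "complex mat"
  assumes "i < dim_col A" "j < dim_row A"
  shows "mat_adjoint A $$ (i, j) = cnj (A $$ (j, i))"
  using assms by (auto simp: mat_adjoint_def mat_of_rows_def)

lemma mat_adjoint_adjoint [simp]: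
  fixes A :: "complex mat"
  shows "mat_adjoint (mat_adjoint A) = A"
  by (intro eq_matI) (auto simp: mat_adjoint_entry)

lemma mat_adjoint_one [simp]: "mat_adjoint (1\<^sub>m n :: complex mat) = 1\<^sub>m n"
  by (intro eq_matI) (auto simp: mat_adjoint_entry)

lemma mat_adjoint_mult:
  fixes A B :: "complex mat"
  assumes "A \<in> carrier_mat n m" "B \<in> carrier_mat m p"
  shows "mat_adjoint (A * B) = mat_adjoint B * mat_adjoint A"
proof (rule eq_matI)
  fix i j assume "i < dim_row (mat_adjoint B * mat_adjoint A)"
    and "j < dim_col (mat_adjoint B * mat_adjoint A)"
  then have ij: "i < p" "j < n" using assms by auto
  then have "mat_adjoint (A * B) $$ (i, j) = cnj ((A * B) $$ (j, i))"
    using assms by (intro mat_adjoint_entry) auto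
  also have "\<dots> = (\<Sum>k<m. mat_adjoint B $$ (i, k) * mat_adjoint A $$ (k, j))"
    using assms ij by (simp add: mult_mat_entry[OF assms] mat_adjoint_entry mult.commute del: index_mult_mat)
  also have "\<dots> = (mat_adjoint B * mat_adjoint A) $$ (i, j)"
    using assms ij by (intro mult_mat_entry[symmetric]) auto
  finally show "mat_adjoint (A * B) $$ (i, j) = (mat_adjoint B * mat_adjoint A) $$ (i, j)" .
qed (use assms in auto)

lemma mat_adjoint_add:
  fixes A B :: "complex mat"
  assumes "A \<in> carrier_mat n m" "B \<in> carrier_mat n m"
  shows "mat_adjoint (A + B) = mat_adjoint A + mat_adjoint B"
  using assms by (intro eq_matI) (auto simp: mat_adjoint_entry)

lemma mat_adjoint_minus:
  fixes A B :: "complex mat"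
  assumes "A \<in> carrier_mat n m" "B \<in> carrier_mat n m"
  shows "mat_adjoint (A - B) = mat_adjoint A - mat_adjoint B"
  using assms by (intro eq_matI) (auto simp: mat_adjoint_entry)

lemma mat_adjoint_smult:
  fixes A :: "complex mat"
  shows "mat_adjoint (c \<cdot>\<^sub>m A) = cnj c \<cdot>\<^sub>m mat_adjoint A"
  by (intro eq_matI) (auto simp: mat_adjoint_entry)

lemma hermitian_entry:
  assumes "M \<in> carrier_mat n n" "mat_adjoint M = M" "i < n" "j < n"
  shows "cnj (M $$ (j, i)) = M $$ (i, j)"
  using mat_adjoint_entry[of i M j] assms by (metis carrier_matD)

lemma smult_smult_mat:
  fixes M :: "complex mat"
  shows "a \<cdot>\<^sub>m (b \<cdot>\<^sub>m M) = (a * b) \<cdot>\<^sub>m M"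
  by (intro eq_matI) auto

lemma smult_minus_distrib_mat:
  fixes A B :: "complex mat"
  assumes "A \<in> carrier_mat n n" "B \<in> carrier_mat n n"
  shows "c \<cdot>\<^sub>m (A - B) = c \<cdot>\<^sub>m A - c \<cdot>\<^sub>m B"
  using assms by (intro eq_matI) (auto simp: algebra_simps)

section \<open>Unitary conjugation and the Frobenius norm\<close>

lemma unitary_matI:
  assumes "U \<in> carrier_mat n n" "mat_adjoint U * U = 1\<^sub>m n"
  shows "unitary_mat n U"
  unfolding unitary_mat_def
  using assms mat_mult_left_right_inverse[of "mat_adjoint U" n U] by simp

lemma unitary_mat_mult:
  assumes "unitary_mat n U" "unitary_mat n V"
  shows "unitary_mat n (U * V)"
proof (rule unitary_matI)
  have U: "U \<in> carrier_mat n n" "mat_adjoint U * U = 1\<^sub>m n"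
    and V: "V \<in> carrier_mat n n" "mat_adjoint V * V = 1\<^sub>m n"
    using assms by (auto simp: unitary_mat_def)
  show "U * V \<in> carrier_mat n n" using U V by simp
  have "mat_adjoint (U * V) * (U * V) = mat_adjoint V * ((mat_adjoint U * U) * V)"
    using U(1) V(1) by (simp add: mat_adjoint_mult[of U n n V n] assoc_mult_mat[of _ n n _ n _ n])
  also have "\<dots> = 1\<^sub>m n" using U V by simp
  finally show "mat_adjoint (U * V) * (U * V) = 1\<^sub>m n" .
qed

definition unitary_conj :: "complex mat \<Rightarrow> complex mat \<Rightarrow> complex mat" where
  "unitary_conj U M = mat_adjoint U * M * U"

lemma unitary_matD:
  assumes "unitary_mat n U"
  shows "U \<in> carrier_mat n n" "U * mat_adjoint U = 1\<^sub>m n" "mat_adjoint U * U = 1\<^sub>m n"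
  using assms by (auto simp: unitary_mat_def)

lemma unitary_conj_carrier [simp]:
  "unitary_mat n U \<Longrightarrow> M \<in> carrier_mat n n \<Longrightarrow> unitary_conj U M \<in> carrier_mat n n"
  by (simp add: unitary_conj_def unitary_mat_def)

lemma unitary_mat_adjoint: "unitary_mat n U \<Longrightarrow> unitary_mat n (mat_adjoint U)"
  by (simp add: unitary_mat_def)

lemma unitary_conj_mult:
  assumes "unitary_mat n U" "M \<in> carrier_mat n n" "N \<in> carrier_mat n n"
  shows "unitary_conj U (M * N) = unitary_conj U M * unitary_conj U N"
proof -
  note U = unitary_matD[OF assms(1)]
  have "unitary_conj U M * unitary_conj U N = mat_adjoint U * (M * ((U * mat_adjoint U) * (N * U)))"
    using U(1) assms(2,3) by (simp add: unitary_conj_def assoc_mult_mat[of _ n n _ n _ n])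
  then show ?thesis
    unfolding U(2) using U(1) assms(2,3)
    by (simp add: unitary_conj_def assoc_mult_mat[of _ n n _ n _ n])
qed

lemma unitary_conj_add:
  assumes "unitary_mat n U" "M \<in> carrier_mat n n" "N \<in> carrier_mat n n"
  shows "unitary_conj U (M + N) = unitary_conj U M + unitary_conj U N"
  using assms unitary_matD(1)[OF assms(1)]
  by (simp add: unitary_conj_def mult_add_distrib_mat[of _ n n _ n] add_mult_distrib_mat[of _ n n _ _ n])

lemma unitary_conj_minus:
  assumes "unitary_mat n U" "M \<in> carrier_mat n n" "N \<in> carrier_mat n n"
  shows "unitary_conj U (M - N) = unitary_conj U M - unitary_conj U N"
  using assms unitary_matD(1)[OF assms(1)]
  by (simp add: unitary_conj_def mult_minus_distrib_mat[of _ n n _ n] minus_mult_distrib_mat[of _ n n _ _ n])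

lemma unitary_conj_adjoint:
  assumes "unitary_mat n U" "M \<in> carrier_mat n n"
  shows "unitary_conj U (mat_adjoint M) = mat_adjoint (unitary_conj U M)"
  using assms unitary_matD(1)[OF assms(1)]
  by (simp add: unitary_conj_def mat_adjoint_mult[of _ n n _ n] assoc_mult_mat[of _ n n _ n _ n])

lemma unitary_conj_smult:
  assumes "unitary_mat n U" "M \<in> carrier_mat n n"
  shows "unitary_conj U (c \<cdot>\<^sub>m M) = c \<cdot>\<^sub>m unitary_conj U M"
  using assms unitary_matD(1)[OF assms(1)]
  by (simp add: unitary_conj_def mult_smult_distrib[of _ n n _ n] mult_smult_assoc_mat[of _ n n _ n])

lemma unitary_conj_cancel:
  assumes "unitary_mat n U" "M \<in> carrier_mat n n"
  shows "U * unitary_conj U M * mat_adjoint U = M"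
proof -
  note U = unitary_matD[OF assms(1)]
  have "U * unitary_conj U M * mat_adjoint U = (U * mat_adjoint U) * M * (U * mat_adjoint U)"
    using U(1) assms(2) by (simp add: unitary_conj_def assoc_mult_mat[of _ n n _ n _ n])
  then show ?thesis unfolding U(2) using assms(2) by simp
qed

lemma unitary_conj_eq_zero_iff:
  assumes "unitary_mat n U" "M \<in> carrier_mat n n"
  shows "unitary_conj U M = 0\<^sub>m n n \<longleftrightarrow> M = 0\<^sub>m n n"
  using unitary_conj_cancel[OF assms] unitary_matD(1)[OF assms(1)]
  by (auto simp: unitary_conj_def)

definition frob_sq :: "complex mat \<Rightarrow> real" where
  "frob_sq M = (\<Sum>i<dim_row M. \<Sum>j<dim_col M. (cmod (M $$ (i, j)))\<^sup>2)"

lemma mat_trace_mult: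
  assumes "A \<in> carrier_mat n m" "B \<in> carrier_mat m n"
  shows "mat_trace (A * B) = (\<Sum>i<n. \<Sum>j<m. A $$ (i, j) * B $$ (j, i))"
  using assms by (simp add: mat_trace_def mult_mat_entry del: index_mult_mat(1))

lemma mat_trace_comm:
  assumes "A \<in> carrier_mat n m" "B \<in> carrier_mat m n"
  shows "mat_trace (A * B) = mat_trace (B * A)"
  unfolding mat_trace_mult[OF assms] mat_trace_mult[OF assms(2,1)]
  by (subst sum.swap) (simp add: mult.commute)

lemma mat_trace_add:
  assumes "A \<in> carrier_mat n n" "B \<in> carrier_mat n n"
  shows "mat_trace (A + B) = mat_trace A + mat_trace B"
  using assms by (simp add: mat_trace_def sum.distrib)

lemma mat_trace_minus:
  assumes "A \<in> carrier_mat n n" "B \<in> carrier_mat n n"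
  shows "mat_trace (A - B) = mat_trace A - mat_trace B"
  using assms by (simp add: mat_trace_def sum_subtractf)

lemma mat_trace_smult:
  assumes "A \<in> carrier_mat n n"
  shows "mat_trace (c \<cdot>\<^sub>m A) = c * mat_trace A"
  using assms by (simp add: mat_trace_def sum_distrib_left)

lemma mat_trace_adjoint:
  assumes "A \<in> carrier_mat n n"
  shows "mat_trace (mat_adjoint A) = cnj (mat_trace A)"
  using assms by (simp add: mat_trace_def mat_adjoint_entry)

lemma frob_sq_trace:
  assumes "M \<in> carrier_mat n m"
  shows "mat_trace (M * mat_adjoint M) = of_real (frob_sq M)"
  using assms
  by (simp add: mat_trace_mult[of _ n m] frob_sq_def mat_adjoint_entry complex_mult_cnj cmod_power2)

lemma frobenius_norm_eq_sqrt: "frobenius_norm M = sqrt (frob_sq M)"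
  using frob_sq_trace[of M "dim_row M" "dim_col M"] by (simp add: frobenius_norm_def)

lemma frob_sq_nonneg [simp]: "frob_sq M \<ge> 0"
  by (auto simp: frob_sq_def intro!: sum_nonneg)

lemma frob_sq_eq_zeroD:
  assumes "frob_sq M = 0" "i < dim_row M" "j < dim_col M"
  shows "M $$ (i, j) = 0"
proof -
  have "(\<Sum>j<dim_col M. (cmod (M $$ (i, j)))\<^sup>2) = 0"
    using assms(1,2) unfolding frob_sq_def
    by (subst (asm) sum_nonneg_eq_0_iff) (auto intro: sum_nonneg)
  then show ?thesis using assms(3) by (subst (asm) sum_nonneg_eq_0_iff) auto
qed

lemma frob_sq_eq_zero_iff:
  assumes "M \<in> carrier_mat n m"
  shows "frob_sq M = 0 \<longleftrightarrow> M = 0\<^sub>m n m"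
proof
  assume "frob_sq M = 0"
  then show "M = 0\<^sub>m n m" using assms frob_sq_eq_zeroD[of M] by (intro eq_matI) auto
qed (simp add: frob_sq_def)

lemma frob_sq_smult: "frob_sq (c \<cdot>\<^sub>m M) = (cmod c)\<^sup>2 * frob_sq M"
  by (simp add: frob_sq_def norm_mult power_mult_distrib sum_distrib_left)

lemma unitary_conj_trace:
  assumes "unitary_mat n U" "M \<in> carrier_mat n n"
  shows "mat_trace (unitary_conj U M) = mat_trace M"
proof -
  note U = unitary_matD[OF assms(1)]
  have "mat_trace (unitary_conj U M) = mat_trace (U * (mat_adjoint U * M))"
    unfolding unitary_conj_def using U assms(2) by (intro mat_trace_comm[of _ n n]) auto
  also have "U * (mat_adjoint U * M) = (U * mat_adjoint U) * M"
    using U(1) assms(2) by (simp add: assoc_mult_mat[of _ n n _ n _ n])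
  finally show ?thesis using U(2) assms(2) by simp
qed

lemma unitary_conj_frob_sq:
  assumes "unitary_mat n U" "M \<in> carrier_mat n n"
  shows "frob_sq (unitary_conj U M) = frob_sq M"
proof -
  have "complex_of_real (frob_sq (unitary_conj U M)) = mat_trace (unitary_conj U (M * mat_adjoint M))"
    using assms by (simp add: frob_sq_trace[of _ n n, symmetric] unitary_conj_mult unitary_conj_adjoint)
  also have "\<dots> = of_real (frob_sq M)"
    using assms by (simp add: unitary_conj_trace frob_sq_trace)
  finally show ?thesis by simp
qed

section \<open>The spectral theorem for Hermitian matrices\<close>

text \<open>
Complete \<open>v\<close> to a basis, orthogonalise it keeping \<open>v\<close> in front, and rescale the columns to length one.
\<close>

lemma unitary_with_first_column:
  fixes v :: "complex vec"
  assumes v: "v \<in> carrier_vec n" and v0: "v \<noteq> 0\<^sub>v n"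
  shows "\<exists>U c. unitary_mat n U \<and> (\<forall>i<n. U $$ (i, 0) = c * v $ i)"
proof -
  interpret cof_vec_space n "TYPE(complex)" .
  define b where "b = basis_completion v"
  define ws where "ws = gram_schmidt n b"
  have n: "n > 0" using v v0 by (cases n) auto
  from basis_completion[OF v v0, folded b_def]
  have span_b: "span (set b) = carrier_vec n" and dist_b: "distinct b" 
    and indep: "\<not> lin_dep (set b)" and b: "set b \<subseteq> carrier_vec n" and hdb: "hd b = v" 
    and len_b: "length b = n" by auto
  from hdb len_b n obtain vs where bv: "b = v # vs" by (cases b, auto)
  from gram_schmidt_result[OF b dist_b indep refl, folded ws_def]
  have ws: "set ws \<subseteq> carrier_vec n" "corthogonal ws" "length ws = n" 
    by (auto simp: len_b)
  from gram_schmidt_hd[OF v, of vs, folded bv] have hdws: "hd ws = v" unfolding ws_def .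
  have ws0: "ws ! 0 = v" using hdws ws(3) n by (cases ws) auto
  have wc: "ws ! j \<in> carrier_vec n" if "j < n" for j using ws that by auto
  \<comment> \<open>the reciprocal lengths of the orthogonal columns\<close>
  define r where "r j = 1 / sqrt (\<Sum>k<n. (cmod (ws ! j $ k))\<^sup>2)" for j
  define U where "U = mat n n (\<lambda>(i, j). of_real (r j) * ws ! j $ i)"
  have U: "U \<in> carrier_mat n n" by (simp add: U_def)
  have prod: "(\<Sum>k<n. ws ! j $ k * cnj (ws ! i $ k)) = ws ! j \<bullet>c ws ! i" if "i < n" "j < n" for i j
    using wc[OF that(1)] wc[OF that(2)] by (simp add: scalar_prod_def atLeast0LessThan)
  have sq: "(\<Sum>k<n. ws ! j $ k * cnj (ws ! j $ k)) = of_real (\<Sum>k<n. (cmod (ws ! j $ k))\<^sup>2)" for j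
    by (simp add: complex_mult_cnj cmod_power2)
  have "mat_adjoint U * U = 1\<^sub>m n"
  proof (rule eq_matI)
    fix i j assume "i < dim_row (1\<^sub>m n)" "j < dim_col (1\<^sub>m n)"
    then have ij: "i < n" "j < n" by auto
    have "(mat_adjoint U * U) $$ (i, j) = (\<Sum>k<n. mat_adjoint U $$ (i, k) * U $$ (k, j))"
      using U ij by (intro mult_mat_entry) auto
    also have "\<dots> = (\<Sum>k<n. of_real (r i * r j) * (ws ! j $ k * cnj (ws ! i $ k)))"
      using ij U by (intro sum.cong) (auto simp: mat_adjoint_entry U_def)
    also have "\<dots> = of_real (r i * r j) * (ws ! j \<bullet>c ws ! i)"
      using prod[OF ij] by (simp add: sum_distrib_left[symmetric])
    also have "\<dots> = (if i = j then 1 else 0)"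
    proof (cases "i = j")
      case False
      then show ?thesis using corthogonalD[OF ws(2), of j i] ij ws(3) by auto
    next
      case True
      define s where "s = (\<Sum>k<n. (cmod (ws ! j $ k))\<^sup>2)"
      have "ws ! j \<bullet>c ws ! j \<noteq> 0" using corthogonalD[OF ws(2), of j j] ij ws(3) by auto
      then have "s \<noteq> 0" using prod[OF ij(2) ij(2)] sq[of j, folded s_def] by auto
      moreover have "s \<ge> 0" by (auto simp: s_def intro: sum_nonneg)
      ultimately have "r j * r j * s = 1" by (simp add: r_def s_def[symmetric] field_simps)
      moreover have "ws ! j \<bullet>c ws ! j = of_real s" using prod[OF ij(2) ij(2)] sq[of j] by (simp add: s_def)
      ultimately show ?thesis using True by (metis of_real_1 of_real_mult)
    qed
    finally show "(mat_adjoint U * U) $$ (i, j) = 1\<^sub>m n $$ (i, j)" using ij by simp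
  qed (use U in auto)
  with U have "unitary_mat n U" by (rule unitary_matI)
  moreover have "\<forall>i<n. U $$ (i, 0) = of_real (r 0) * v $ i"
    using n by (auto simp: U_def ws0)
  ultimately show ?thesis by blast
qed

text \<open>
Induction on the order: in an orthonormal basis that starts with an eigenvector the first column is a
multiple of the first unit vector, by symmetry so is the first row, and the remaining block is again
Hermitian.
\<close>

theorem hermitian_diagonalisation:
  assumes "A \<in> carrier_mat n n" "mat_adjoint A = A"
  shows "\<exists>U d. unitary_mat n U \<and> mat_adjoint U * A * U = mat_diag n (\<lambda>i. complex_of_real (d i))"
  using assms
proof (induction n arbitrary: A)
  case 0
  then show ?case by (intro exI[of _ "1\<^sub>m 0"] exI[of _ "\<lambda>_. 0"]) (auto simp: unitary_mat_def mat_diag_def intro!: eq_matI)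
next
  case (Suc m)
  let ?n = "Suc m"
  note A = Suc.prems(1) and herm = Suc.prems(2)
  obtain e where "eigenvalue A e"
    using spectrum_non_empty[OF A] by (auto simp: spectrum_def)
  then obtain v where v: "v \<in> carrier_vec ?n" "v \<noteq> 0\<^sub>v ?n" "A *\<^sub>v v = e \<cdot>\<^sub>v v"
    using A by (auto simp: eigenvalue_def eigenvector_def)
  obtain U c where Uu: "unitary_mat ?n U" and U0: "\<forall>i<?n. U $$ (i, 0) = c * v $ i"
    using unitary_with_first_column[OF v(1,2)] by blast
  have U: "U \<in> carrier_mat ?n ?n" and UU: "mat_adjoint U * U = 1\<^sub>m ?n"
    using Uu by (auto simp: unitary_mat_def)
  define A' where "A' = mat_adjoint U * A * U"
  have A': "A' \<in> carrier_mat ?n ?n" using A U by (simp add: A'_def)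
  have herm': "mat_adjoint A' = A'"
    using A U herm
    by (simp add: A'_def mat_adjoint_mult[of _ ?n ?n _ ?n] assoc_mult_mat[of _ ?n ?n _ ?n _ ?n])
  have AU0: "(A * U) $$ (k, 0) = e * U $$ (k, 0)" if k: "k < ?n" for k
  proof -
    have "(A * U) $$ (k, 0) = (\<Sum>l<?n. A $$ (k, l) * U $$ (l, 0))"
      using A U k by (intro mult_mat_entry) auto
    also have "\<dots> = c * (\<Sum>l<?n. A $$ (k, l) * v $ l)"
      using U0 by (simp add: sum_distrib_left mult.left_commute del: sum.lessThan_Suc)
    also have "(\<Sum>l<?n. A $$ (k, l) * v $ l) = (A *\<^sub>v v) $ k"
      using A v(1) k by (auto simp: scalar_prod_def atLeast0LessThan simp del: sum.lessThan_Suc)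
    finally show ?thesis using v k U0 by simp
  qed
  have col0: "A' $$ (i, 0) = (if i = 0 then e else 0)" if i: "i < ?n" for i
  proof -
    have "A' $$ (i, 0) = (mat_adjoint U * (A * U)) $$ (i, 0)"
      using A U by (simp add: A'_def assoc_mult_mat[of _ ?n ?n _ ?n _ ?n])
    also have "\<dots> = (\<Sum>k<?n. mat_adjoint U $$ (i, k) * (A * U) $$ (k, 0))"
      using A U i by (intro mult_mat_entry) auto
    also have "\<dots> = e * (\<Sum>k<?n. mat_adjoint U $$ (i, k) * U $$ (k, 0))"
      by (simp add: AU0 sum_distrib_left mult.left_commute del: sum.lessThan_Suc)
    also have "(\<Sum>k<?n. mat_adjoint U $$ (i, k) * U $$ (k, 0)) = (mat_adjoint U * U) $$ (i, 0)"
      using U i by (intro mult_mat_entry[symmetric]) auto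
    finally show ?thesis using UU i by simp
  qed
  have sym: "A' $$ (i, j) = cnj (A' $$ (j, i))" if "i < ?n" "j < ?n" for i j
    using mat_adjoint_entry[of i A' j] that A' herm' by simp
  have ereal: "e = of_real (Re e)"
    using sym[of 0 0] col0[of 0] by (simp add: complex_eq_iff)
  define B where "B = mat m m (\<lambda>(i, j). A' $$ (Suc i, Suc j))"
  have B: "B \<in> carrier_mat m m" by (simp add: B_def)
  have "mat_adjoint B = B"
    by (intro eq_matI) (auto simp: B_def mat_adjoint_entry sym[symmetric])
  then obtain V d where Vu: "unitary_mat m V"
    and VBV: "mat_adjoint V * B * V = mat_diag m (\<lambda>i. complex_of_real (d i))"
    using Suc.IH[OF B] by blast
  have V: "V \<in> carrier_mat m m" "mat_adjoint V * V = 1\<^sub>m m"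
    using Vu by (auto simp: unitary_mat_def)
  let ?W = "four_block_mat (1\<^sub>m 1) (0\<^sub>m 1 m) (0\<^sub>m m 1) V"
  let ?E = "mat 1 1 (\<lambda>_. e)"
  have A'_block: "A' = four_block_mat ?E (0\<^sub>m 1 m) (0\<^sub>m m 1) B"
  proof (rule eq_matI)
    fix i j assume "i < dim_row (four_block_mat ?E (0\<^sub>m 1 m) (0\<^sub>m m 1) B)"
      "j < dim_col (four_block_mat ?E (0\<^sub>m 1 m) (0\<^sub>m m 1) B)"
    then have ij: "i < ?n" "j < ?n" using B by auto
    show "A' $$ (i, j) = four_block_mat ?E (0\<^sub>m 1 m) (0\<^sub>m m 1) B $$ (i, j)"
      using ij B col0[OF ij(1)] col0[OF ij(2)] sym[of 0 j]
      by (cases i; cases j) (auto simp: B_def)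
  qed (use A' B in auto)
  have W: "?W \<in> carrier_mat ?n ?n" using four_block_carrier_mat[of "1\<^sub>m 1" 1 1 V m m] V by simp
  have Wadj: "mat_adjoint ?W = four_block_mat (1\<^sub>m 1) (0\<^sub>m 1 m) (0\<^sub>m m 1) (mat_adjoint V)"
    using V by (intro eq_matI) (auto simp: mat_adjoint_entry)
  have mult: "four_block_mat E (0\<^sub>m 1 m) (0\<^sub>m m 1) M * four_block_mat F (0\<^sub>m 1 m) (0\<^sub>m m 1) N
      = four_block_mat (E * F) (0\<^sub>m 1 m) (0\<^sub>m m 1) (M * N)"
    if "E \<in> carrier_mat 1 1" "F \<in> carrier_mat 1 1" "M \<in> carrier_mat m m" "N \<in> carrier_mat m m"
    for E F M N :: "complex mat"
    using that by (subst mult_four_block_mat[of _ 1 1 _ m _ m _ _ 1 _ m]) auto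
  have "mat_adjoint ?W * ?W = 1\<^sub>m ?n"
    unfolding Wadj using V by (subst mult) auto
  with W have Wu: "unitary_mat ?n ?W" by (rule unitary_matI)
  have "mat_adjoint (U * ?W) * A * (U * ?W) = mat_adjoint ?W * A' * ?W"
    using A U W by (simp add: A'_def mat_adjoint_mult[of _ ?n ?n _ ?n] assoc_mult_mat[of _ ?n ?n _ ?n _ ?n])
  also have "\<dots> = four_block_mat ?E (0\<^sub>m 1 m) (0\<^sub>m m 1) (mat_adjoint V * B * V)"
  proof -
    have "mat_adjoint ?W * A' = four_block_mat (1\<^sub>m 1 * ?E) (0\<^sub>m 1 m) (0\<^sub>m m 1) (mat_adjoint V * B)"
      unfolding Wadj A'_block using V B by (intro mult) auto
    also have "\<dots> * ?W = four_block_mat (1\<^sub>m 1 * ?E * 1\<^sub>m 1) (0\<^sub>m 1 m) (0\<^sub>m m 1) (mat_adjoint V * B * V)"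
      using V B by (intro mult) auto
    also have "1\<^sub>m 1 * ?E * 1\<^sub>m 1 = ?E" by auto
    finally show ?thesis .
  qed
  also have "\<dots> = mat_diag ?n (\<lambda>i. complex_of_real (case_nat (Re e) d i))"
    unfolding VBV using ereal
    by (intro eq_matI) (auto simp: mat_diag_def split: nat.splits)
  finally show ?case using unitary_mat_mult[OF Uu Wu] by blast
qed

text \<open>
Conjugation by the permutation matrix of \<open>\<pi>\<close> relabels the entries of a matrix.
\<close>

lemma unitary_diagonalisation_permute:
  assumes U: "unitary_mat n U" and A: "A \<in> carrier_mat n n"
    and d: "unitary_conj U A = mat_diag n d" and p: "\<pi> permutes {..<n}"
  shows "\<exists>V. unitary_mat n V \<and> unitary_conj V A = mat_diag n (d \<circ> \<pi>)"
proof -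
  define P where "P = mat n n (\<lambda>(i, j). if i = \<pi> j then 1 else 0 :: complex)"
  have P: "P \<in> carrier_mat n n" by (simp add: P_def)
  note Uc = unitary_matD(1)[OF U]
  have pi: "\<pi> j < n" if "j < n" for j using permutes_in_image[OF p] that by auto
  have conjP: "unitary_conj P M $$ (i, j) = M $$ (\<pi> i, \<pi> j)"
    if "M \<in> carrier_mat n n" "i < n" "j < n" for M i j
  proof -
    have "(mat_adjoint P * M) $$ (i, k) = M $$ (\<pi> i, k)" if "k < n" for k
    proof -
      have "(mat_adjoint P * M) $$ (i, k) = (\<Sum>l<n. mat_adjoint P $$ (i, l) * M $$ (l, k))"
        using P \<open>M \<in> _\<close> \<open>i < n\<close> that by (intro mult_mat_entry) auto
      also have "\<dots> = (\<Sum>l<n. if l = \<pi> i then M $$ (l, k) else 0)"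
        using \<open>i < n\<close> by (intro sum.cong) (auto simp: P_def mat_adjoint_entry)
      also have "\<dots> = M $$ (\<pi> i, k)" using pi \<open>i < n\<close> by simp
      finally show ?thesis .
    qed
    moreover have "unitary_conj P M $$ (i, j) = (\<Sum>k<n. (mat_adjoint P * M) $$ (i, k) * P $$ (k, j))"
      unfolding unitary_conj_def using P that by (intro mult_mat_entry) auto
    ultimately have "unitary_conj P M $$ (i, j) = (\<Sum>k<n. M $$ (\<pi> i, k) * P $$ (k, j))"
      by simp
    also have "\<dots> = (\<Sum>k<n. if k = \<pi> j then M $$ (\<pi> i, k) else 0)"
      using that by (intro sum.cong) (auto simp: P_def)
    also have "\<dots> = M $$ (\<pi> i, \<pi> j)" using pi \<open>j < n\<close> by simp
    finally show ?thesis .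
  qed
  have inj: "\<pi> i = \<pi> j \<longleftrightarrow> i = j" for i j using permutes_inj[OF p] by (auto dest: injD)
  have "unitary_conj P (1\<^sub>m n) = 1\<^sub>m n"
  proof (rule eq_matI)
    fix i j assume "i < dim_row (1\<^sub>m n :: complex mat)" "j < dim_col (1\<^sub>m n :: complex mat)"
    then have "i < n" "j < n" by auto
    then show "unitary_conj P (1\<^sub>m n) $$ (i, j) = 1\<^sub>m n $$ (i, j)"
      by (simp add: conjP pi inj)
  qed (use P in \<open>auto simp: unitary_conj_def\<close>)
  then have Pu: "unitary_mat n P" using P by (intro unitary_matI) (auto simp: unitary_conj_def)
  have "unitary_conj (U * P) A = unitary_conj P (unitary_conj U A)"
    using Uc P A by (simp add: unitary_conj_def mat_adjoint_mult[of _ n n _ n] assoc_mult_mat[of _ n n _ n _ n])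
  also have "\<dots> = mat_diag n (d \<circ> \<pi>)"
  proof (rule eq_matI)
    fix i j assume "i < dim_row (mat_diag n (d \<circ> \<pi>))" "j < dim_col (mat_diag n (d \<circ> \<pi>))"
    then have "i < n" "j < n" by (auto simp: mat_diag_def)
    then show "unitary_conj P (unitary_conj U A) $$ (i, j) = mat_diag n (d \<circ> \<pi>) $$ (i, j)"
      unfolding d by (simp add: conjP) (simp add: mat_diag_def pi inj)
  qed (use P d in \<open>auto simp: unitary_conj_def mat_diag_def\<close>)
  finally show ?thesis using unitary_mat_mult[OF U Pu] by blast
qed

text \<open>
The variance bound only distinguishes the largest and the smallest eigenvalue from the others, so these
two are moved to the positions 0 and 1, where the corner of order two sits in the final statement.
Choosing the minimum among the remaining positions keeps the two positions distinct even if all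
eigenvalues agree.
\<close>

lemma hermitian_diagonalisation_extremal:
  assumes A: "A \<in> carrier_mat n n" "mat_adjoint A = A" and n: "n \<ge> 2"
  shows "\<exists>U d. unitary_mat n U \<and> unitary_conj U A = mat_diag n (\<lambda>i. complex_of_real (d i)) \<and>
           (\<forall>i<n. d 1 \<le> d i \<and> d i \<le> d 0)"
proof -
  obtain U d where U: "unitary_mat n U" and d: "unitary_conj U A = mat_diag n (\<lambda>i. complex_of_real (d i))"
    using hermitian_diagonalisation[OF A] unfolding unitary_conj_def by blast
  have fin: "finite (d ` {..<n})" "d ` {..<n} \<noteq> {}" using n by (auto simp: lessThan_empty_iff)
  obtain i0 where "i0 < n" and i0_Max: "Max (d ` {..<n}) = d i0"
    using Max_in[OF fin] by auto
  then have i0: "i0 < n" "\<And>i. i < n \<Longrightarrow> d i \<le> d i0"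
    using Max_ge[OF fin(1)] by auto
  define J where "J = {..<n} - {i0}"
  have J: "finite (d ` J)" "d ` J \<noteq> {}"
  proof -
    have "card J > 0" using n i0(1) by (simp add: J_def)
    then have "J \<noteq> {}" by (metis card.empty less_irrefl)
    then show "finite (d ` J)" "d ` J \<noteq> {}" by (auto simp: J_def)
  qed
  obtain j0 where "j0 \<in> J" and j0_Min: "Min (d ` J) = d j0"
    using Min_in[OF J] by auto
  then have j0: "j0 \<in> J" "\<And>i. i \<in> J \<Longrightarrow> d j0 \<le> d i"
    using Min_le[OF J(1)] by auto
  define \<tau> where "\<tau> = Transposition.transpose 0 i0"
  define \<pi> where "\<pi> = \<tau> \<circ> Transposition.transpose 1 (\<tau> j0)"
  have j0': "j0 < n" "j0 \<noteq> i0" using j0(1) by (auto simp: J_def)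
  have tau: "\<tau> permutes {..<n}" unfolding \<tau>_def using i0(1) n by (intro permutes_swap_id) auto
  have "\<tau> j0 < n" using permutes_in_image[OF tau] j0' by auto
  then have "Transposition.transpose 1 (\<tau> j0) permutes {..<n}" using n by (intro permutes_swap_id) auto
  then have pi: "\<pi> permutes {..<n}" unfolding \<pi>_def using tau by (intro permutes_compose)
  have "\<tau> j0 \<noteq> 0" using j0' by (auto simp: \<tau>_def Transposition.transpose_def)
  then have pi01: "\<pi> 0 = i0" "\<pi> 1 = j0" by (simp_all add: \<pi>_def \<tau>_def)
  obtain V where V: "unitary_mat n V"
      "unitary_conj V A = mat_diag n ((\<lambda>i. complex_of_real (d i)) \<circ> \<pi>)"
    using unitary_diagonalisation_permute[OF U A(1) d pi] by blast
  have "d (\<pi> 1) \<le> d (\<pi> i) \<and> d (\<pi> i) \<le> d (\<pi> 0)" if "i < n" for i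
  proof -
    have "\<pi> i < n" using permutes_in_image[OF pi] that by auto
    then show ?thesis
      unfolding pi01 using i0 j0(2)[of "\<pi> i"] i0(2)[of j0] j0' by (cases "\<pi> i = i0") (auto simp: J_def)
  qed
  then show ?thesis
    using V by (intro exI[of _ V] exI[of _ "d \<circ> \<pi>"]) (auto simp: o_def)
qed

section \<open>A variance bound for Hermitian matrices\<close>

text \<open>
The difference between half the sum of squares and the variance is a sum of terms that are all
nonnegative once \<open>d 0\<close> is the maximum and \<open>d 1\<close> the minimum of \<open>d\<close>. The product
\<open>(d 0 - d i) * (d i - d 1)\<close> comes from the usual proof that a variance is at most
\<open>(max - min)\<^sup>2 / 4\<close>.
\<close>

lemma variance_defect:
  fixes d p :: "nat \<Rightarrow> real"
  assumes n: "n \<ge> 2" and p: "sum p {..<n} = 1"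
  defines "\<mu> \<equiv> \<Sum>i<n. p i * d i"
  shows "(\<Sum>i<n. (d i)\<^sup>2) / 2 - ((\<Sum>i<n. p i * (d i)\<^sup>2) - \<mu>\<^sup>2) =
     (\<Sum>i=2..<n. (d i)\<^sup>2) / 2 + (\<Sum>i<n. p i * ((d 0 - d i) * (d i - d 1)))
     + (d 0 + d 1)\<^sup>2 / 4 + (\<mu> - (d 0 + d 1) / 2)\<^sup>2"
proof -
  have "(\<Sum>i<n. p i * ((d 0 - d i) * (d i - d 1)))
      = (\<Sum>i<n. (d 0 + d 1) * (p i * d i) - d 0 * d 1 * p i - p i * (d i)\<^sup>2)"
    by (intro sum.cong refl) (simp add: algebra_simps power2_eq_square)
  also have "\<dots> = (d 0 + d 1) * \<mu> - d 0 * d 1 - (\<Sum>i<n. p i * (d i)\<^sup>2)"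
    using p by (simp add: sum_subtractf sum_distrib_left[symmetric] \<mu>_def)
  finally have G: "(\<Sum>i<n. p i * ((d 0 - d i) * (d i - d 1)))
      = (d 0 + d 1) * \<mu> - d 0 * d 1 - (\<Sum>i<n. p i * (d i)\<^sup>2)" .
  have "{..<n} = {0, 1} \<union> {2..<n}" using n by auto
  then have "(\<Sum>i<n. (d i)\<^sup>2) = (d 0)\<^sup>2 + (d 1)\<^sup>2 + (\<Sum>i=2..<n. (d i)\<^sup>2)"
    by (simp add: sum.union_disjoint)
  then show ?thesis unfolding G by (simp add: field_simps power2_eq_square)
qed

text \<open>
In the case of equality all terms of the defect vanish: the values are \<open>d 0\<close>, \<open>- d 0\<close> and zeros, the
mean is zero, and the probability is concentrated on the two nonzero values.
\<close>

lemma variance_le_half_sum_squares: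
  fixes d p :: "nat \<Rightarrow> real"
  assumes n: "n \<ge> 2" and p: "sum p {..<n} = 1" "\<And>i. i < n \<Longrightarrow> p i \<ge> 0"
    and d: "\<And>i. i < n \<Longrightarrow> d 1 \<le> d i \<and> d i \<le> d 0"
  shows "(\<Sum>i<n. p i * (d i)\<^sup>2) - (\<Sum>i<n. p i * d i)\<^sup>2 \<le> (\<Sum>i<n. (d i)\<^sup>2) / 2"
    and "(\<Sum>i<n. p i * (d i)\<^sup>2) - (\<Sum>i<n. p i * d i)\<^sup>2 = (\<Sum>i<n. (d i)\<^sup>2) / 2 \<Longrightarrow>
      (\<Sum>i<n. p i * d i) = 0 \<and> d 1 = - d 0 \<and>
      (\<forall>i<n. 2 \<le> i \<longrightarrow> d i = 0 \<and> (d 0 = 0 \<or> p i = 0))"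
proof -
  define \<mu> where "\<mu> = (\<Sum>i<n. p i * d i)"
  define R where "R = (\<Sum>i=2..<n. (d i)\<^sup>2)"
  define G where "G = (\<Sum>i<n. p i * ((d 0 - d i) * (d i - d 1)))"
  have summand: "p i * ((d 0 - d i) * (d i - d 1)) \<ge> 0" if "i < n" for i
    using p(2)[OF that] d[OF that] by simp
  have R: "R \<ge> 0" unfolding R_def by (intro sum_nonneg) auto
  have G: "G \<ge> 0" unfolding G_def using summand by (intro sum_nonneg) auto
  note defect = variance_defect[OF n p(1), of d, folded \<mu>_def R_def G_def]
  show "(\<Sum>i<n. p i * (d i)\<^sup>2) - (\<Sum>i<n. p i * d i)\<^sup>2 \<le> (\<Sum>i<n. (d i)\<^sup>2) / 2"
    using defect R G zero_le_power2[of "d 0 + d 1"] zero_le_power2[of "\<mu> - (d 0 + d 1) / 2"]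
    unfolding \<mu>_def[symmetric] by linarith
  assume "(\<Sum>i<n. p i * (d i)\<^sup>2) - (\<Sum>i<n. p i * d i)\<^sup>2 = (\<Sum>i<n. (d i)\<^sup>2) / 2"
  then have 0: "R = 0" "G = 0" "(d 0 + d 1)\<^sup>2 = 0" "(\<mu> - (d 0 + d 1) / 2)\<^sup>2 = 0"
    using defect R G zero_le_power2[of "d 0 + d 1"] zero_le_power2[of "\<mu> - (d 0 + d 1) / 2"]
    unfolding \<mu>_def[symmetric] by linarith+
  then have d1: "d 1 = - d 0" and mu: "\<mu> = 0" by auto
  have dz: "d i = 0" if "i < n" "2 \<le> i" for i
    using 0(1) that unfolding R_def by (subst (asm) sum_nonneg_eq_0_iff) auto
  have "p i * ((d 0 - d i) * (d i - d 1)) = 0" if "i < n" for i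
    using 0(2) that summand unfolding G_def by (subst (asm) sum_nonneg_eq_0_iff) auto
  then have "d 0 = 0 \<or> p i = 0" if "i < n" "2 \<le> i" for i
    using that dz[OF that] d1 by force
  then show "(\<Sum>i<n. p i * d i) = 0 \<and> d 1 = - d 0 \<and>
      (\<forall>i<n. 2 \<le> i \<longrightarrow> d i = 0 \<and> (d 0 = 0 \<or> p i = 0))"
    using d1 mu dz by (auto simp: \<mu>_def)
qed

text \<open>
For \<open>Y\<close> of norm one this is twice a density matrix.
\<close>

definition sym_gram :: "complex mat \<Rightarrow> complex mat" where
  "sym_gram Y = mat_adjoint Y * Y + Y * mat_adjoint Y"

lemma sym_gram_carrier [simp]: "Y \<in> carrier_mat n n \<Longrightarrow> sym_gram Y \<in> carrier_mat n n"
  by (simp add: sym_gram_def)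

lemma unitary_conj_sym_gram:
  assumes "unitary_mat n U" "Y \<in> carrier_mat n n"
  shows "unitary_conj U (sym_gram Y) = sym_gram (unitary_conj U Y)"
  using assms by (simp add: sym_gram_def unitary_conj_add unitary_conj_mult unitary_conj_adjoint)

text \<open>
The squared length of the \<open>i\<close>-th row of \<open>Y\<close> averaged with that of the \<open>i\<close>-th column. If it is zero,
row and column vanish, which is how the support of the distribution controls the support of \<open>Y\<close>.
\<close>

definition line_weight :: "complex mat \<Rightarrow> nat \<Rightarrow> real" where
  "line_weight Y i = (\<Sum>k<dim_row Y. (cmod (Y $$ (k, i)))\<^sup>2 + (cmod (Y $$ (i, k)))\<^sup>2) / 2"

lemma sym_gram_diagonal:
  assumes "Y \<in> carrier_mat n n" "i < n"
  shows "sym_gram Y $$ (i, i) = of_real (2 * line_weight Y i)"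
proof -
  have "(mat_adjoint Y * Y) $$ (i, i) = (\<Sum>k<n. of_real ((cmod (Y $$ (k, i)))\<^sup>2))"
    using assms by (subst mult_mat_entry[of _ n n _ n])
      (auto simp: mat_adjoint_entry complex_mult_cnj cmod_power2 mult.commute[of "cnj _"] simp del: of_real_power intro!: sum.cong)
  moreover have "(Y * mat_adjoint Y) $$ (i, i) = (\<Sum>k<n. of_real ((cmod (Y $$ (i, k)))\<^sup>2))"
    using assms by (subst mult_mat_entry[of _ n n _ n])
      (auto simp: mat_adjoint_entry complex_mult_cnj cmod_power2 simp del: of_real_power intro!: sum.cong)
  ultimately show ?thesis
    using assms unfolding sym_gram_def
    by (subst index_add_mat) (auto simp: line_weight_def sum.distrib simp del: index_mult_mat(1))
qed

lemma sum_line_weight: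
  assumes "Y \<in> carrier_mat n n"
  shows "(\<Sum>i<n. line_weight Y i) = frob_sq Y"
proof -
  have "(\<Sum>i<n. line_weight Y i) =
      ((\<Sum>i<n. \<Sum>k<n. (cmod (Y $$ (k, i)))\<^sup>2) + (\<Sum>i<n. \<Sum>k<n. (cmod (Y $$ (i, k)))\<^sup>2)) / 2"
    using assms by (simp add: line_weight_def sum.distrib sum_divide_distrib[symmetric])
  also have "(\<Sum>i<n. \<Sum>k<n. (cmod (Y $$ (k, i)))\<^sup>2) = (\<Sum>i<n. \<Sum>k<n. (cmod (Y $$ (i, k)))\<^sup>2)"
    by (rule sum.swap)
  finally show ?thesis using assms by (simp add: frob_sq_def)
qed

lemma mat_trace_diag_mult:
  assumes "M \<in> carrier_mat n n"
  shows "mat_trace (mat_diag n f * M) = (\<Sum>i<n. f i * M $$ (i, i))"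
  using assms by (simp add: mat_diag_mult_left[of M n n] mat_trace_def)

definition two_level :: "nat \<Rightarrow> real \<Rightarrow> complex mat" where
  "two_level n a = mat_diag n (\<lambda>i. complex_of_real (if i = 0 then a else if i = 1 then - a else 0))"

text \<open>
The matrix vanishes outside its upper left block of order two.
\<close>

definition corner2 :: "complex mat \<Rightarrow> bool" where
  "corner2 M \<longleftrightarrow> (\<forall>i<dim_row M. \<forall>j<dim_col M. 2 \<le> i \<or> 2 \<le> j \<longrightarrow> M $$ (i, j) = 0)"

text \<open>
After diagonalising \<open>A\<close>, the two traces are the second moment and the mean of the eigenvalues under the
probabilities \<open>line_weight Y'\<close>, where \<open>Y'\<close> is \<open>Y\<close> in the eigenbasis; each is doubled because the trace
of \<open>sym_gram Y\<close> is 2.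
\<close>

lemma hermitian_variance:
  assumes n: "n \<ge> 2" and A: "A \<in> carrier_mat n n" "mat_adjoint A = A"
    and Y: "Y \<in> carrier_mat n n" "frob_sq Y = 1"
  shows "2 * Re (mat_trace (A * A * sym_gram Y)) - (Re (mat_trace (A * sym_gram Y)))\<^sup>2 \<le> 2 * frob_sq A"
      (is ?le)
    and "2 * Re (mat_trace (A * A * sym_gram Y)) - (Re (mat_trace (A * sym_gram Y)))\<^sup>2 = 2 * frob_sq A \<Longrightarrow>
      Re (mat_trace (A * sym_gram Y)) = 0 \<and> (A = 0\<^sub>m n n \<or>
       (\<exists>U a. unitary_mat n U \<and> a \<noteq> 0 \<and>
          unitary_conj U A = two_level n a \<and>
          corner2 (unitary_conj U Y)))" (is "?eq \<Longrightarrow> ?conc")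
proof -
  obtain U d where U: "unitary_mat n U" and d: "unitary_conj U A = mat_diag n (\<lambda>i. complex_of_real (d i))"
    and ext: "\<And>i. i < n \<Longrightarrow> d 1 \<le> d i \<and> d i \<le> d 0"
    using hermitian_diagonalisation_extremal[OF A n] by blast
  define Y' where "Y' = unitary_conj U Y"
  have Y': "Y' \<in> carrier_mat n n" using U Y by (simp add: Y'_def)
  define p where "p = line_weight Y'"
  have p: "sum p {..<n} = 1"
    using sum_line_weight[OF Y'] unitary_conj_frob_sq[OF U Y(1)] Y(2) by (simp add: p_def Y'_def)
  have p0: "p i \<ge> 0" for i by (auto simp: p_def line_weight_def sum.distrib intro!: sum_nonneg divide_nonneg_nonneg add_nonneg_nonneg)
  have t1: "Re (mat_trace (A * sym_gram Y)) = 2 * (\<Sum>i<n. p i * d i)"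
  proof -
    have "mat_trace (A * sym_gram Y) = mat_trace (mat_diag n (\<lambda>i. complex_of_real (d i)) * sym_gram Y')"
      using unitary_conj_trace[OF U, of "A * sym_gram Y"] U A(1) Y(1)
      by (simp add: unitary_conj_mult unitary_conj_sym_gram d Y'_def)
    also have "\<dots> = of_real (\<Sum>i<n. d i * (2 * p i))"
      using Y' by (simp add: mat_trace_diag_mult sym_gram_diagonal p_def)
    also have "(\<Sum>i<n. d i * (2 * p i)) = 2 * (\<Sum>i<n. p i * d i)"
      by (simp add: sum_distrib_left mult_ac)
    finally show ?thesis by (metis Re_complex_of_real)
  qed
  have t2: "Re (mat_trace (A * A * sym_gram Y)) = 2 * (\<Sum>i<n. p i * (d i)\<^sup>2)"
  proof -
    have "mat_trace (A * A * sym_gram Y) = mat_trace (mat_diag n (\<lambda>i. complex_of_real (d i * d i)) * sym_gram Y')"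
      using unitary_conj_trace[OF U, of "A * A * sym_gram Y"] U A(1) Y(1)
      by (simp add: unitary_conj_mult[OF U mult_carrier_mat[of _ n n _ n]] unitary_conj_mult[of n] unitary_conj_sym_gram d Y'_def)
    also have "\<dots> = of_real (\<Sum>i<n. d i * d i * (2 * p i))"
      using Y' by (simp add: mat_trace_diag_mult sym_gram_diagonal p_def)
    also have "(\<Sum>i<n. d i * d i * (2 * p i)) = 2 * (\<Sum>i<n. p i * (d i)\<^sup>2)"
      by (simp add: sum_distrib_left mult_ac power2_eq_square)
    finally show ?thesis by (metis Re_complex_of_real)
  qed
  have t3: "frob_sq A = (\<Sum>i<n. (d i)\<^sup>2)"
  proof -
    have "complex_of_real (frob_sq A) = mat_trace (unitary_conj U A * mat_adjoint (unitary_conj U A))"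
      using frob_sq_trace[of "unitary_conj U A" n n] unitary_conj_frob_sq[OF U A(1)] U A(1) by simp
    also have "\<dots> = mat_trace (unitary_conj U A * unitary_conj U A)"
      using unitary_conj_adjoint[OF U A(1)] A(2) by simp
    also have "\<dots> = of_real (\<Sum>i<n. (d i)\<^sup>2)"
      by (simp add: d) (simp add: mat_diag_def mat_trace_def power2_eq_square)
    finally show ?thesis using of_real_eq_iff by blast
  qed
  note var = variance_le_half_sum_squares[OF n p p0 ext]
  show ?le using var(1) unfolding t1 t2 t3 by (simp add: power_mult_distrib)
  assume ?eq
  then have "(\<Sum>i<n. p i * (d i)\<^sup>2) - (\<Sum>i<n. p i * d i)\<^sup>2 = (\<Sum>i<n. (d i)\<^sup>2) / 2"
    unfolding t1 t2 t3 by (simp add: power_mult_distrib)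
  then have eq: "(\<Sum>i<n. p i * d i) = 0" "d 1 = - d 0"
      "\<And>i. i < n \<Longrightarrow> 2 \<le> i \<Longrightarrow> d i = 0 \<and> (d 0 = 0 \<or> p i = 0)"
    using var(2) by blast+
  have d': "mat_diag n (\<lambda>i. complex_of_real (d i)) = two_level n (d 0)"
    using eq(2,3) unfolding two_level_def mat_diag_def by (intro cong_mat refl) (auto simp: not_less_eq_eq numeral_2_eq_2)
  show ?conc
  proof (intro conjI)
    show "Re (mat_trace (A * sym_gram Y)) = 0" using t1 eq(1) by simp
    show "A = 0\<^sub>m n n \<or> (\<exists>U a. unitary_mat n U \<and> a \<noteq> 0 \<and>
          unitary_conj U A = two_level n a \<and>
          corner2 (unitary_conj U Y))"
    proof (cases "d 0 = 0")
      case True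
      then have "unitary_conj U A = 0\<^sub>m n n" unfolding d d' by (auto simp: two_level_def mat_diag_def intro!: eq_matI)
      then show ?thesis using unitary_conj_eq_zero_iff[OF U A(1)] by blast
    next
      case False
      have "Y' $$ (k, i) = 0 \<and> Y' $$ (i, k) = 0" if i: "i < n" "2 \<le> i" and k: "k < n" for i k
      proof -
        have "(\<Sum>k<n. (cmod (Y' $$ (k, i)))\<^sup>2 + (cmod (Y' $$ (i, k)))\<^sup>2) = 0"
          using eq(3)[OF i] False Y' by (simp add: p_def line_weight_def)
        then have "(cmod (Y' $$ (k, i)))\<^sup>2 + (cmod (Y' $$ (i, k)))\<^sup>2 = 0"
          using k by (subst (asm) sum_nonneg_eq_0_iff) auto
        then show ?thesis by (simp add: add_nonneg_eq_0_iff)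
      qed
      then have "corner2 Y'" using Y' by (auto simp: corner2_def)
      then show ?thesis using U False d d' Y'_def by metis
    qed
  qed
qed

section \<open>The Boettcher-Wenzel inequality\<close>

text \<open>
The residual of the orthogonal projection of \<open>W\<close> to the line through \<open>Y\<close> has a nonnegative squared norm.
\<close>

lemma frob_cauchy_schwarz_unit:
  assumes W: "W \<in> carrier_mat n n" and Y: "Y \<in> carrier_mat n n" "frob_sq Y = 1"
  shows "(cmod (mat_trace (W * mat_adjoint Y)))\<^sup>2 \<le> frob_sq W"
proof -
  define s where "s = mat_trace (W * mat_adjoint Y)"
  define Z where "Z = W - s \<cdot>\<^sub>m Y"
  have Z: "Z \<in> carrier_mat n n" using W Y by (simp add: Z_def)
  have sY: "mat_trace (Y * mat_adjoint W) = cnj s"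
    using mat_trace_adjoint[of "W * mat_adjoint Y" n] W Y by (simp add: s_def mat_adjoint_mult[of _ n n _ n])
  have "Z * mat_adjoint Z = W * mat_adjoint W - s \<cdot>\<^sub>m (Y * mat_adjoint W)
      - (cnj s \<cdot>\<^sub>m (W * mat_adjoint Y) - (s * cnj s) \<cdot>\<^sub>m (Y * mat_adjoint Y))"
    using W Y unfolding Z_def
    by (simp add: mat_adjoint_minus[of _ n n] mat_adjoint_smult mult_minus_distrib_mat[of _ n n _ n]
        minus_mult_distrib_mat[of _ n n _ _ n] mult_smult_distrib[of _ n n _ n] mult_smult_assoc_mat[of _ n n _ n]
        smult_smult_mat smult_minus_distrib_mat[of _ n] mult.commute)
  then have "complex_of_real (frob_sq Z) = frob_sq W - s * cnj s - (cnj s * s - s * cnj s * frob_sq Y)"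
    using frob_sq_trace[OF Z] W Y
    by (simp add: mat_trace_minus[of _ n] mat_trace_smult[of _ n] frob_sq_trace[of _ n n] sY s_def[symmetric])
  also have "\<dots> = of_real (frob_sq W - (cmod s)\<^sup>2)"
    using Y by (simp add: complex_norm_square del: of_real_power)
  finally have "frob_sq Z = frob_sq W - (cmod s)\<^sup>2" using of_real_eq_iff by blast
  then show ?thesis using frob_sq_nonneg[of Z] by (simp add: s_def)
qed

lemma commutator_carrier [simp]:
  "X \<in> carrier_mat n n \<Longrightarrow> Y \<in> carrier_mat n n \<Longrightarrow> commutator X Y \<in> carrier_mat n n"
  by (simp add: commutator_def)

text \<open>
Expanding both norms gives eight traces of words of length four; up to cyclic rotation the mixed words
\<open>X Y X\<^sup>* Y\<^sup>*\<close> and \<open>Y X Y\<^sup>* X\<^sup>*\<close> occur with opposite signs, and the other four make up the right-hand side.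
\<close>

lemma frob_sq_commutator_identity:
  assumes X: "X \<in> carrier_mat n n" and Y: "Y \<in> carrier_mat n n"
  shows "complex_of_real (frob_sq (commutator X Y) + frob_sq (mat_adjoint X * Y + Y * mat_adjoint X))
    = mat_trace ((mat_adjoint X * X + X * mat_adjoint X) * sym_gram Y)"
proof -
  define F where "F = mat_adjoint X"
  define G where "G = mat_adjoint Y"
  have F: "F \<in> carrier_mat n n" and G: "G \<in> carrier_mat n n" using X Y by (simp_all add: F_def G_def)
  have adj: "mat_adjoint X = F" "mat_adjoint Y = G" "mat_adjoint F = X" "mat_adjoint G = Y"
    by (simp_all add: F_def G_def)
  note expand = mult_minus_distrib_mat[of _ n n _ n] minus_mult_distrib_mat[of _ n n _ _ n]
    mult_add_distrib_mat[of _ n n _ n] add_mult_distrib_mat[of _ n n _ _ n]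
    assoc_mult_mat[of _ n n _ n _ n] mat_trace_add[of _ n] mat_trace_minus[of _ n]
  have rot: "mat_trace (P * (Q * (R * T))) = mat_trace (Q * (R * (T * P)))"
    if "P \<in> carrier_mat n n" "Q \<in> carrier_mat n n" "R \<in> carrier_mat n n" "T \<in> carrier_mat n n" for P Q R T
    using mat_trace_comm[of P n n "Q * (R * T)"] that by (simp add: assoc_mult_mat[of _ n n _ n _ n])
  have 1: "complex_of_real (frob_sq (commutator X Y)) = mat_trace (X * (Y * (G * F)))
      - mat_trace (Y * (X * (G * F))) - (mat_trace (X * (Y * (F * G))) - mat_trace (Y * (X * (F * G))))"
    using X Y F G
    by (simp add: frob_sq_trace[of _ n n, symmetric] commutator_def mat_adjoint_minus[of _ n n]
        mat_adjoint_mult[of _ n n _ n] adj expand)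
  have 2: "complex_of_real (frob_sq (F * Y + Y * F)) = mat_trace (F * (Y * (G * X)))
      + mat_trace (Y * (F * (G * X))) + (mat_trace (F * (Y * (X * G))) + mat_trace (Y * (F * (X * G))))"
    using X Y F G
    by (simp add: frob_sq_trace[of _ n n, symmetric] mat_adjoint_add[of _ n n]
        mat_adjoint_mult[of _ n n _ n] adj expand)
  have 3: "mat_trace ((F * X + X * F) * sym_gram Y) = mat_trace (F * (X * (G * Y)))
      + mat_trace (X * (F * (G * Y))) + (mat_trace (F * (X * (Y * G))) + mat_trace (X * (F * (Y * G))))"
    using X Y F G by (simp add: sym_gram_def adj expand)
  have "mat_trace (Y * (X * (G * F))) = mat_trace (F * (Y * (X * G)))"
    using rot[of F Y X G] X Y F G by simp
  moreover have "mat_trace (X * (Y * (F * G))) = mat_trace (Y * (F * (G * X)))"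
    using rot[of X Y F G] X Y F G by simp
  moreover have "mat_trace (X * (Y * (G * F))) = mat_trace (F * (X * (Y * G)))"
    using rot[of F X Y G] X Y F G by simp
  moreover have "mat_trace (Y * (X * (F * G))) = mat_trace (X * (F * (G * Y)))"
    using rot[of Y X F G] X Y F G by simp
  moreover have "mat_trace (F * (Y * (G * X))) = mat_trace (X * (F * (Y * G)))"
    using rot[of X F Y G] X Y F G by simp
  moreover have "mat_trace (Y * (F * (X * G))) = mat_trace (F * (X * (G * Y)))"
    using rot[of Y F X G] X Y F G by simp
  ultimately show ?thesis using 1 2 3 by (simp add: adj)
qed

lemma cartesian_decomposition:
  fixes X :: "complex mat"
  assumes X: "X \<in> carrier_mat n n"
  obtains A B where "A \<in> carrier_mat n n" "B \<in> carrier_mat n n" "mat_adjoint A = A" "mat_adjoint B = B"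
    "X = A + \<i> \<cdot>\<^sub>m B"
proof
  let ?A = "(1 / 2) \<cdot>\<^sub>m (X + mat_adjoint X)" and ?B = "(- \<i> / 2) \<cdot>\<^sub>m (X - mat_adjoint X)"
  show "?A \<in> carrier_mat n n" "?B \<in> carrier_mat n n" using X by simp_all
  show "mat_adjoint ?A = ?A" "mat_adjoint ?B = ?B" "X = ?A + \<i> \<cdot>\<^sub>m ?B"
    using X by (auto intro!: eq_matI simp: mat_adjoint_entry field_simps)
qed

lemma adjoint_cartesian:
  fixes A B :: "complex mat"
  assumes "A \<in> carrier_mat n n" "B \<in> carrier_mat n n" "mat_adjoint A = A" "mat_adjoint B = B"
  shows "mat_adjoint (A + \<i> \<cdot>\<^sub>m B) = A - \<i> \<cdot>\<^sub>m B"
  using assms by (simp add: mat_adjoint_add[of _ n n] mat_adjoint_smult) (auto intro!: eq_matI)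

lemma sym_gram_cartesian:
  fixes A B :: "complex mat"
  assumes A: "A \<in> carrier_mat n n" "mat_adjoint A = A" and B: "B \<in> carrier_mat n n" "mat_adjoint B = B"
  shows "sym_gram (A + \<i> \<cdot>\<^sub>m B) = 2 \<cdot>\<^sub>m (A * A + B * B)"
proof -
  have "sym_gram (A + \<i> \<cdot>\<^sub>m B) = (A * A - \<i> \<cdot>\<^sub>m (B * A) + (\<i> \<cdot>\<^sub>m (A * B) - (\<i> * \<i>) \<cdot>\<^sub>m (B * B)))
     + (A * A + \<i> \<cdot>\<^sub>m (B * A) - (\<i> \<cdot>\<^sub>m (A * B) + (\<i> * \<i>) \<cdot>\<^sub>m (B * B)))"
    unfolding sym_gram_def using A B
    by (simp add: adjoint_cartesian[of _ n] mult_minus_distrib_mat[of _ n n _ n] minus_mult_distrib_mat[of _ n n _ _ n]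
      mult_add_distrib_mat[of _ n n _ n] add_mult_distrib_mat[of _ n n _ _ n]
      mult_smult_distrib[of _ n n _ n] mult_smult_assoc_mat[of _ n n _ n] smult_smult_mat
      add_smult_distrib_left_mat[of _ n n] smult_minus_distrib_mat[of _ n])
  also have "\<dots> = 2 \<cdot>\<^sub>m (A * A + B * B)"
    using A B by (intro eq_matI) (auto simp del: index_mult_mat(1))
  finally show ?thesis .
qed

lemma mat_trace_hermitian_mult_real:
  assumes "A \<in> carrier_mat n n" "mat_adjoint A = A" "S \<in> carrier_mat n n" "mat_adjoint S = S"
  shows "mat_trace (A * S) = of_real (Re (mat_trace (A * S)))"
proof -
  have "cnj (mat_trace (A * S)) = mat_trace (S * A)"
    using mat_trace_adjoint[of "A * S" n] assms by (simp add: mat_adjoint_mult[of _ n n _ n])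
  also have "\<dots> = mat_trace (A * S)" using assms by (intro mat_trace_comm) auto
  finally show ?thesis by (simp add: complex_eq_iff)
qed

lemma sym_gram_hermitian:
  assumes "Y \<in> carrier_mat n n"
  shows "mat_adjoint (sym_gram Y) = sym_gram Y"
  using assms by (simp add: sym_gram_def mat_adjoint_add[of _ n n] mat_adjoint_mult[of _ n n _ n])

lemma frob_sq_cartesian:
  fixes A B :: "complex mat"
  assumes A: "A \<in> carrier_mat n n" "mat_adjoint A = A" and B: "B \<in> carrier_mat n n" "mat_adjoint B = B"
  shows "frob_sq (A + \<i> \<cdot>\<^sub>m B) = frob_sq A + frob_sq B"
proof -
  let ?X = "A + \<i> \<cdot>\<^sub>m B"
  have X: "?X \<in> carrier_mat n n" using A B by simp
  have "mat_trace (sym_gram ?X) = 2 * of_real (frob_sq ?X)"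
    using X mat_trace_comm[of ?X n n "mat_adjoint ?X"]
    by (simp add: sym_gram_def mat_trace_add[of _ n] frob_sq_trace[of _ n n])
  moreover have "mat_trace (sym_gram ?X) = 2 * of_real (frob_sq A + frob_sq B)"
    using A B frob_sq_trace[OF A(1)] frob_sq_trace[OF B(1)]
    by (simp add: sym_gram_cartesian[of _ n] mat_trace_add[of _ n] mat_trace_smult[of _ n])
  ultimately have "2 * complex_of_real (frob_sq ?X) = 2 * of_real (frob_sq A + frob_sq B)"
    by (simp only:)
  then have "complex_of_real (frob_sq ?X) = of_real (frob_sq A + frob_sq B)"
    by (simp only: mult_cancel_left) simp
  then show ?thesis using of_real_eq_iff by blast
qed

text \<open>
The quantity \<open>gap H\<close> is the slack of the variance bound for \<open>H\<close>. Since \<open>A\<close>, \<open>B\<close> and \<open>sym_gram Y\<close> are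
Hermitian, the traces of \<open>A S\<close> and \<open>B S\<close> are real, so they are the real and the negated imaginary part
of \<open>Tr (X\<^sup>* S)\<close>. In the case of equality both gaps vanish, hence both means vanish, and then the chain of
inequalities leaves no room for the norm of \<open>X\<^sup>* Y + Y X\<^sup>*\<close>.
\<close>

theorem boettcher_wenzel:
  fixes A B Y :: "complex mat"
  assumes n: "n \<ge> 2"
    and A: "A \<in> carrier_mat n n" "mat_adjoint A = A" and B: "B \<in> carrier_mat n n" "mat_adjoint B = B"
    and Y: "Y \<in> carrier_mat n n" "frob_sq Y = 1"
  defines "X \<equiv> A + \<i> \<cdot>\<^sub>m B"
  defines "gap \<equiv> \<lambda>H. 2 * frob_sq H -
     (2 * Re (mat_trace (H * H * sym_gram Y)) - (Re (mat_trace (H * sym_gram Y)))\<^sup>2)"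
  shows "frob_sq (commutator X Y) \<le> 2 * frob_sq X"
    and "frob_sq (commutator X Y) = 2 * frob_sq X \<Longrightarrow>
      gap A = 0 \<and> gap B = 0 \<and> mat_adjoint X * Y + Y * mat_adjoint X = 0\<^sub>m n n"
proof -
  define S where "S = sym_gram Y"
  have S: "S \<in> carrier_mat n n" "mat_adjoint S = S" using Y sym_gram_hermitian by (auto simp: S_def)
  have X: "X \<in> carrier_mat n n" using A B by (simp add: X_def)
  define F where "F = mat_adjoint X"
  have F: "F \<in> carrier_mat n n" "F = A - \<i> \<cdot>\<^sub>m B"
    using A(1) B(1) adjoint_cartesian[OF A(1) B(1) A(2) B(2)] by (simp_all add: F_def X_def)
  define W where "W = F * Y + Y * F"
  have W: "W \<in> carrier_mat n n" using F Y by (simp add: W_def)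
  define tA tB where "tA = Re (mat_trace (A * S))" and "tB = Re (mat_trace (B * S))"
  have "mat_trace (W * mat_adjoint Y) = mat_trace (F * S)"
    using F Y mat_trace_comm[of Y n n "F * mat_adjoint Y"]
    by (simp add: W_def S_def sym_gram_def add_mult_distrib_mat[of _ n n _ _ n] mult_add_distrib_mat[of _ n n _ n]
        mat_trace_add[of _ n] assoc_mult_mat[of _ n n _ n _ n] add.commute)
  also have "\<dots> = mat_trace (A * S) - \<i> * mat_trace (B * S)"
    using A B S by (simp add: F minus_mult_distrib_mat[of _ n n _ _ n] mult_smult_assoc_mat[of _ n n _ n]
        mat_trace_minus[of _ n] mat_trace_smult[of _ n])
  also have "\<dots> = of_real tA - \<i> * of_real tB"
    using mat_trace_hermitian_mult_real[OF A S] mat_trace_hermitian_mult_real[OF B S] by (simp add: tA_def tB_def)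
  finally have "(cmod (mat_trace (W * mat_adjoint Y)))\<^sup>2 = tA\<^sup>2 + tB\<^sup>2"
    by (simp add: cmod_power2)
  then have cs: "tA\<^sup>2 + tB\<^sup>2 \<le> frob_sq W" using frob_cauchy_schwarz_unit[OF W Y] by simp
  have "complex_of_real (frob_sq (commutator X Y) + frob_sq W) = mat_trace (sym_gram X * S)"
    using frob_sq_commutator_identity[OF X Y(1)] by (simp add: W_def F_def sym_gram_def S_def)
  also have "\<dots> = 2 * mat_trace (A * A * S) + 2 * mat_trace (B * B * S)"
    using A B S by (simp add: X_def sym_gram_cartesian[of _ n] add_mult_distrib_mat[of _ n n _ _ n]
        mult_smult_assoc_mat[of _ n n _ n] mat_trace_add[of _ n] mat_trace_smult[of _ n] algebra_simps)
  finally have "Re (complex_of_real (frob_sq (commutator X Y) + frob_sq W)) =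
      Re (2 * mat_trace (A * A * S) + 2 * mat_trace (B * B * S))" by (rule arg_cong)
  then have total: "frob_sq (commutator X Y) + frob_sq W =
      2 * Re (mat_trace (A * A * S)) + 2 * Re (mat_trace (B * B * S))" by simp
  have gaps: "gap A = 2 * frob_sq A - (2 * Re (mat_trace (A * A * S)) - tA\<^sup>2)"
      "gap B = 2 * frob_sq B - (2 * Re (mat_trace (B * B * S)) - tB\<^sup>2)"
    by (simp_all add: gap_def S_def tA_def tB_def)
  have gA: "gap A \<ge> 0" and gB: "gap B \<ge> 0"
    using hermitian_variance(1)[OF n A Y] hermitian_variance(1)[OF n B Y] by (simp_all add: gap_def)
  have fX: "frob_sq X = frob_sq A + frob_sq B" unfolding X_def using A B by (rule frob_sq_cartesian)
  show "frob_sq (commutator X Y) \<le> 2 * frob_sq X"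
    using total gaps gA gB fX cs by linarith
  assume eq: "frob_sq (commutator X Y) = 2 * frob_sq X"
  have g0: "gap A = 0" "gap B = 0" and W0: "frob_sq W = tA\<^sup>2 + tB\<^sup>2"
    using total gaps gA gB fX cs eq by linarith+
  have "tA = 0" "tB = 0"
    using hermitian_variance(2)[OF n A Y] hermitian_variance(2)[OF n B Y] g0
    by (simp_all add: gap_def tA_def tB_def S_def)
  then have "frob_sq W = 0" using W0 by simp
  then show "gap A = 0 \<and> gap B = 0 \<and> mat_adjoint X * Y + Y * mat_adjoint X = 0\<^sub>m n n"
    using g0 frob_sq_eq_zero_iff[OF W] by (simp add: W_def F_def)
qed

section \<open>Matrices attaining the bound live on two dimensions\<close>

text \<open>
Let \<open>M\<close> and \<open>Y\<close> be the matrices with entries \<open>mij\<close> and \<open>yij\<close>. The hypotheses say that the Hermitian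
part of \<open>M\<close> is \<open>diag (a, -a)\<close>, that \<open>M Y + Y M = 0\<close>, and that \<open>z\<close> is annihilated by \<open>Y\<close> and \<open>Y\<^sup>*\<close>. If
\<open>z\<close> were nonzero, then \<open>Y\<close> would be a multiple of \<open>w w\<^sup>*\<close> for \<open>w\<close> orthogonal to \<open>z\<close>. Pairing
\<open>M w w\<^sup>* + w w\<^sup>* M = 0\<close> with \<open>w\<close> on both sides gives \<open>w\<^sup>* M w = 0\<close>, pairing on one side then gives
\<open>M w = 0\<close> and \<open>w\<^sup>* M = 0\<close>, so \<open>w\<close> lies in the kernel of the Hermitian part, which is invertible.
\<close>

lemma no_common_kernel_2x2:
  fixes a :: real and m00 m01 m10 m11 y00 y01 y10 y11 z0 z1 :: complex
  assumes a: "a \<noteq> 0"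
    and h00: "m00 + cnj m00 = 2 * a" and h11: "m11 + cnj m11 = - 2 * a" and h01: "m01 + cnj m10 = 0"
    and e00: "m00 * y00 + m01 * y10 + (y00 * m00 + y01 * m10) = 0"
    and e01: "m00 * y01 + m01 * y11 + (y00 * m01 + y01 * m11) = 0"
    and e10: "m10 * y00 + m11 * y10 + (y10 * m00 + y11 * m10) = 0"
    and e11: "m10 * y01 + m11 * y11 + (y10 * m01 + y11 * m11) = 0"
    and k: "y00 * z0 + y01 * z1 = 0" "y10 * z0 + y11 * z1 = 0"
    and k': "cnj z0 * y00 + cnj z1 * y10 = 0" "cnj z0 * y01 + cnj z1 * y11 = 0"
    and y: "\<not> (y00 = 0 \<and> y01 = 0 \<and> y10 = 0 \<and> y11 = 0)"
  shows "z0 = 0 \<and> z1 = 0"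
proof (rule ccontr)
  assume z: "\<not> (z0 = 0 \<and> z1 = 0)"
  define s0 s1 where "s0 = cnj z0" and "s1 = cnj z1"
  define q where "q = z0 * s0 + z1 * s1"
  have q0: "q \<noteq> 0"
  proof
    assume "q = 0"
    then have "complex_of_real ((cmod z0)\<^sup>2 + (cmod z1)\<^sup>2) = 0"
      by (simp add: q_def s0_def s1_def complex_norm_square del: of_real_power)
    then have "(cmod z0)\<^sup>2 + (cmod z1)\<^sup>2 = 0" by (simp only: of_real_eq_0_iff)
    then show False using z by (simp add: add_nonneg_eq_0_iff)
  qed
  \<comment> \<open>With \<open>w = (- s1, s0)\<close>, which is orthogonal to \<open>z\<close>, this is \<open>w\<^sup>* Y w\<close>; it comes from
    \<open>(w w\<^sup>* + z z\<^sup>*) Y (w w\<^sup>* + z z\<^sup>*) = q\<^sup>2 Y\<close>, where only the term \<open>w w\<^sup>* Y w w\<^sup>*\<close> survives.\<close>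
  define c where "c = z1 * y00 * s1 - z1 * y01 * s0 - z0 * y10 * s1 + z0 * y11 * s0"
  note k' = k'[folded s0_def s1_def]
  have y00: "q * q * y00 = c * (s1 * z1)" and y01: "q * q * y01 = - c * (s1 * z0)"
    and y10: "q * q * y10 = - c * (s0 * z1)" and y11: "q * q * y11 = c * (s0 * z0)"
    using k k' unfolding c_def q_def by Groebner_Basis.algebra+
  have c0: "c \<noteq> 0" using y00 y01 y10 y11 y q0 by auto
  \<comment> \<open>\<open>u = M w\<close> and \<open>v = w\<^sup>* M\<close>\<close>
  define u0 u1 where "u0 = m01 * s0 - m00 * s1" and "u1 = m11 * s0 - m10 * s1"
  define v0 v1 where "v0 = z0 * m10 - z1 * m00" and "v1 = z0 * m11 - z1 * m01"
  have r00: "- u0 * z1 - s1 * v0 = 0" and r01: "u0 * z0 - s1 * v1 = 0"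
    and r10: "- u1 * z1 + s0 * v0 = 0" and r11: "u1 * z0 + s0 * v1 = 0"
  proof -
    have "c * (- u0 * z1 - s1 * v0) = q * q * (m00 * y00 + m01 * y10 + (y00 * m00 + y01 * m10))"
      unfolding u0_def v0_def using y00 y01 y10 y11 by Groebner_Basis.algebra
    then show "- u0 * z1 - s1 * v0 = 0" unfolding e00 using c0 by simp
    have "c * (u0 * z0 - s1 * v1) = q * q * (m00 * y01 + m01 * y11 + (y00 * m01 + y01 * m11))"
      unfolding u0_def v1_def using y00 y01 y10 y11 by Groebner_Basis.algebra
    then show "u0 * z0 - s1 * v1 = 0" unfolding e01 using c0 by simp
    have "c * (- u1 * z1 + s0 * v0) = q * q * (m10 * y00 + m11 * y10 + (y10 * m00 + y11 * m10))"
      unfolding u1_def v0_def using y00 y01 y10 y11 by Groebner_Basis.algebra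
    then show "- u1 * z1 + s0 * v0 = 0" unfolding e10 using c0 by simp
    have "c * (u1 * z0 + s0 * v1) = q * q * (m10 * y01 + m11 * y11 + (y10 * m01 + y11 * m11))"
      unfolding u1_def v1_def using y00 y01 y10 y11 by Groebner_Basis.algebra
    then show "u1 * z0 + s0 * v1 = 0" unfolding e11 using c0 by simp
  qed
  \<comment> \<open>\<open>s = w\<^sup>* M w\<close>\<close>
  define s where "s = z0 * u1 - z1 * u0"
  have s': "s = v1 * s0 - v0 * s1"
    unfolding s_def u0_def u1_def v0_def v1_def by Groebner_Basis.algebra
  have "2 * (q * s) = 0" using r00 r01 r10 r11 s' s_def q_def by Groebner_Basis.algebra
  then have s0': "s = 0" using q0 by simp
  have "q * u0 = 0" "q * u1 = 0" "q * v0 = 0" "q * v1 = 0"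
    using r00 r01 r10 r11 s' s_def s0' q_def by Groebner_Basis.algebra+
  then have uv: "u0 = 0" "u1 = 0" "v0 = 0" "v1 = 0" using q0 by auto
  have "cnj v0 = 0" "cnj v1 = 0" using uv by auto
  then have cv: "s0 * cnj m10 - s1 * cnj m00 = 0" "s0 * cnj m11 - s1 * cnj m01 = 0"
    by (simp_all add: v0_def v1_def s0_def s1_def)
  have "cnj (m01 + cnj m10) = 0" unfolding h01 by simp
  then have h10: "m10 + cnj m01 = 0" by (simp add: add.commute)
  have "(m00 + cnj m00) * s1 = 0" using uv(1) cv(1) h01 unfolding u0_def by Groebner_Basis.algebra
  moreover have "(m11 + cnj m11) * s0 = 0" using uv(2) cv(2) h10 unfolding u1_def by Groebner_Basis.algebra
  ultimately have "s0 = 0" "s1 = 0" using h00 h11 a by auto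
  then show False using q0 by (simp add: q_def)
qed

definition corner_proj :: "nat \<Rightarrow> complex mat" where
  "corner_proj n = mat_diag n (\<lambda>i. if i < 2 then 1 else 0)"

lemma two_level_carrier [simp]: "two_level n a \<in> carrier_mat n n"
  by (simp add: two_level_def)

lemma corner_proj_carrier [simp]: "corner_proj n \<in> carrier_mat n n"
  by (simp add: corner_proj_def)

lemma two_level_entry:
  "i < n \<Longrightarrow> j < n \<Longrightarrow>
    two_level n a $$ (i, j) = (if i = j then of_real (if i = 0 then a else if i = 1 then - a else 0) else 0)"
  by (simp add: two_level_def mat_diag_def)

lemma mat_trace_two_level: "n \<ge> 2 \<Longrightarrow> mat_trace (two_level n a) = 0"
proof -
  assume n: "n \<ge> 2"
  then have "{..<n} = {0, 1} \<union> {2..<n}" by auto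
  then show ?thesis using n by (simp add: mat_trace_def two_level_def mat_diag_def sum.union_disjoint)
qed

lemma corner2_two_level: "corner2 (two_level n a)"
  by (auto simp: corner2_def two_level_def mat_diag_def)

lemma corner2D:
  "corner2 M \<Longrightarrow> M \<in> carrier_mat n m \<Longrightarrow> i < n \<Longrightarrow> j < m \<Longrightarrow> 2 \<le> i \<or> 2 \<le> j \<Longrightarrow> M $$ (i, j) = 0"
  by (auto simp: corner2_def)

lemma corner_proj_mult_corner2:
  assumes "M \<in> carrier_mat n n" "corner2 M"
  shows "corner_proj n * M = M" "M * corner_proj n = M"
  using assms
  by (auto simp: corner_proj_def mat_diag_mult_left[of M n n] mat_diag_mult_right[of M n n] corner2_def
      intro!: eq_matI)

lemma corner_proj_idem: "corner_proj n * corner_proj n = corner_proj n"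
  by (simp add: corner_proj_def) (intro arg_cong[where f = "mat_diag n"] ext, simp)

lemma corner_proj_adjoint: "mat_adjoint (corner_proj n) = corner_proj n"
  by (intro eq_matI) (auto simp: corner_proj_def mat_diag_def mat_adjoint_entry)

lemma mat_trace_corner_proj: "n \<ge> 2 \<Longrightarrow> mat_trace (corner_proj n) = 2"
proof -
  assume n: "n \<ge> 2"
  then have "{..<n} = {0, 1} \<union> {2..<n}" by auto
  then show ?thesis using n by (simp add: mat_trace_def corner_proj_def mat_diag_def sum.union_disjoint)
qed

lemma unitary_conj_adjoint_cancel:
  assumes "unitary_mat n U" "M \<in> carrier_mat n n"
  shows "unitary_conj (mat_adjoint U) (unitary_conj U M) = M"
  using unitary_conj_cancel[OF assms] by (simp add: unitary_conj_def)

text \<open>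
\<open>P\<close> is the orthogonal projection to the range of \<open>B\<close>, at least when \<open>b\<close> is nonzero.
\<close>

lemma two_level_support_projection:
  assumes n: "n \<ge> 2" and V: "unitary_mat n V" and B: "B \<in> carrier_mat n n" and Y: "Y \<in> carrier_mat n n"
    and b: "unitary_conj V B = two_level n b" and cY: "corner2 (unitary_conj V Y)"
  obtains P where "P \<in> carrier_mat n n" "P * P = P" "mat_adjoint P = P" "mat_trace P = 2"
    "P * Y = Y" "Y * P = Y" "B * P = B"
proof
  define P where "P = unitary_conj (mat_adjoint V) (corner_proj n)"
  note V' = unitary_mat_adjoint[OF V]
  have conv: "unitary_conj (mat_adjoint V) (corner_proj n * unitary_conj V M) = P * M"
    "unitary_conj (mat_adjoint V) (unitary_conj V M * corner_proj n) = M * P"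
    if "M \<in> carrier_mat n n" for M
    using that V by (simp_all add: unitary_conj_mult[OF V'] unitary_conj_adjoint_cancel P_def)
  show "P \<in> carrier_mat n n" using V' by (simp add: P_def)
  show "P * P = P" "mat_adjoint P = P" "mat_trace P = 2"
    using V' n by (simp_all add: P_def unitary_conj_mult[symmetric] unitary_conj_adjoint[symmetric]
        unitary_conj_trace corner_proj_idem corner_proj_adjoint mat_trace_corner_proj)
  show "P * Y = Y" "Y * P = Y"
    using conv[OF Y] corner_proj_mult_corner2[OF _ cY, of n] V Y by (simp_all add: unitary_conj_adjoint_cancel)
  show "B * P = B"
    using conv[OF B] corner_proj_mult_corner2[of "unitary_conj V B" n] corner2_two_level[of n b] V B
    by (simp add: unitary_conj_adjoint_cancel b[symmetric])
qed

text \<open>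
The corner of \<open>P\<close> already accounts for its trace, so the other diagonal entries sum to zero. Each of them
is the squared length of a row, because \<open>P\<close> is a Hermitian idempotent, so these rows vanish.
\<close>

lemma corner2_projection_support:
  assumes n: "n \<ge> 2" and P: "P \<in> carrier_mat n n" "P * P = P" "mat_adjoint P = P" "mat_trace P = 2"
    and P1: "\<And>i j. i < 2 \<Longrightarrow> j < 2 \<Longrightarrow> P $$ (i, j) = (if i = j then 1 else 0)"
    and B: "B \<in> carrier_mat n n" "mat_adjoint B = B" "B * P = B"
  shows "corner2 B"
proof -
  have Pkk: "P $$ (k, k) = of_real (\<Sum>l<n. (cmod (P $$ (k, l)))\<^sup>2)" if k: "k < n" for k
  proof -
    have "P $$ (k, k) = (\<Sum>l<n. P $$ (k, l) * P $$ (l, k))"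
      using mult_mat_entry[OF P(1) P(1) k k] P(2) by simp
    also have "\<dots> = (\<Sum>l<n. of_real ((cmod (P $$ (k, l)))\<^sup>2))"
    proof (intro sum.cong refl)
      fix l assume "l \<in> {..<n}"
      then have "cnj (P $$ (k, l)) = P $$ (l, k)" using hermitian_entry[OF P(1,3)] k by auto
      then show "P $$ (k, l) * P $$ (l, k) = of_real ((cmod (P $$ (k, l)))\<^sup>2)"
        by (metis complex_norm_square)
    qed
    finally show ?thesis by simp
  qed
  have split: "{..<n} = {0, 1} \<union> {2..<n}" using n by auto
  have "2 = (\<Sum>k<n. P $$ (k, k))" using P(1,4) by (simp add: mat_trace_def)
  also have "\<dots> = 2 + (\<Sum>k=2..<n. P $$ (k, k))"
    unfolding split using P1[of 0 0] P1[of 1 1] by (simp add: sum.union_disjoint)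
  also have "(\<Sum>k=2..<n. P $$ (k, k)) = of_real (\<Sum>k=2..<n. \<Sum>l<n. (cmod (P $$ (k, l)))\<^sup>2)"
    unfolding of_real_sum[of _ "{2..<n}"] by (intro sum.cong refl Pkk) auto
  finally have "complex_of_real (\<Sum>k=2..<n. \<Sum>l<n. (cmod (P $$ (k, l)))\<^sup>2) = 0"
    by (simp only: add_cancel_left_right[of "2::complex"] add_cancel_right_right)
  then have zero: "(\<Sum>k=2..<n. \<Sum>l<n. (cmod (P $$ (k, l)))\<^sup>2) = 0" by (simp only: of_real_eq_0_iff)
  have Pk: "P $$ (k, l) = 0" if "2 \<le> k" "k < n" "l < n" for k l
  proof -
    have "(\<Sum>l<n. (cmod (P $$ (k, l)))\<^sup>2) = 0"
      using zero that by (subst (asm) sum_nonneg_eq_0_iff) (auto intro: sum_nonneg)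
    then show ?thesis using that by (subst (asm) sum_nonneg_eq_0_iff) auto
  qed
  have col: "B $$ (i, k) = 0" if "2 \<le> k" "k < n" "i < n" for i k
  proof -
    have "B $$ (i, k) = (\<Sum>l<n. B $$ (i, l) * P $$ (l, k))"
      using mult_mat_entry[OF B(1) P(1), of i k] B(3) that by simp
    also have "\<dots> = 0"
    proof (intro sum.neutral ballI)
      fix l assume "l \<in> {..<n}"
      then have "cnj (P $$ (k, l)) = P $$ (l, k)" using hermitian_entry[OF P(1,3)] that by auto
      then show "B $$ (i, l) * P $$ (l, k) = 0" using Pk[of k l] that \<open>l \<in> {..<n}\<close> by auto
    qed
    finally show ?thesis .
  qed
  show ?thesis unfolding corner2_def
  proof (intro allI impI)
    fix i j assume "i < dim_row B" "j < dim_col B" "2 \<le> i \<or> 2 \<le> j"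
    then show "B $$ (i, j) = 0" using col[of j i] col[of i j] hermitian_entry[OF B(1,2), of i j] B(1) by auto
  qed
qed

text \<open>
The first two columns of \<open>1 - P\<close>, cut off after two entries, are annihilated by \<open>Y\<close> from the left and,
after taking adjoints, from the right. Hence they are zero and \<open>P\<close> contains the corner; having trace 2,
it is the projection to the corner.
\<close>

lemma extremal_parts_share_corner:
  fixes A B Y :: "complex mat"
  assumes n: "n \<ge> 2"
    and A: "A = two_level n a" "a \<noteq> 0"
    and B: "B \<in> carrier_mat n n" "mat_adjoint B = B"
    and Y: "Y \<in> carrier_mat n n" "corner2 Y" "Y \<noteq> 0\<^sub>m n n"
    and anti: "(A - \<i> \<cdot>\<^sub>m B) * Y + Y * (A - \<i> \<cdot>\<^sub>m B) = 0\<^sub>m n n"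
    and P: "P \<in> carrier_mat n n" "P * P = P" "mat_adjoint P = P" "mat_trace P = 2"
    and PY: "P * Y = Y" "Y * P = Y" and BP: "B * P = B"
  shows "corner2 B"
proof -
  define M where "M = A - \<i> \<cdot>\<^sub>m B"
  have M: "M \<in> carrier_mat n n" using A B by (simp add: M_def)
  have lt: "i < 2 \<Longrightarrow> i < n" for i using n by simp
  have split: "{..<n} = {0, 1} \<union> {2..<n}" using n by auto
  have YN: "(\<Sum>l<n. Y $$ (i, l) * f l) = Y $$ (i, 0) * f 0 + Y $$ (i, 1) * f 1" if "i < n" for i and f :: "nat \<Rightarrow> complex"
    unfolding split using corner2D[OF Y(2,1)] that by (simp add: sum.union_disjoint)
  have NY: "(\<Sum>l<n. f l * Y $$ (l, i)) = f 0 * Y $$ (0, i) + f 1 * Y $$ (1, i)" if "i < n" for i and f :: "nat \<Rightarrow> complex"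
    unfolding split using corner2D[OF Y(2,1)] that by (simp add: sum.union_disjoint)
  have e: "M $$ (i, 0) * Y $$ (0, j) + M $$ (i, 1) * Y $$ (1, j) +
     (Y $$ (i, 0) * M $$ (0, j) + Y $$ (i, 1) * M $$ (1, j)) = 0" if "i < 2" "j < 2" for i j
  proof -
    have "(M * Y + Y * M) $$ (i, j) = (M * Y) $$ (i, j) + (Y * M) $$ (i, j)"
      using M Y that lt by (intro index_add_mat) auto
    also have "\<dots> = M $$ (i, 0) * Y $$ (0, j) + M $$ (i, 1) * Y $$ (1, j) +
       (Y $$ (i, 0) * M $$ (0, j) + Y $$ (i, 1) * M $$ (1, j))"
      using that lt by (simp only: mult_mat_entry[OF M Y(1)] mult_mat_entry[OF Y(1) M] YN NY)
    finally show ?thesis using anti that lt by (simp add: M_def)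
  qed
  have Mentry: "M $$ (i, j) + cnj (M $$ (j, i)) = 2 * A $$ (i, j)" if "i < 2" "j < 2" for i j
    using hermitian_entry[OF B, of i j] that lt B A(1) by (auto simp: M_def two_level_entry)
  have h: "M $$ (0, 0) + cnj (M $$ (0, 0)) = 2 * a" "M $$ (1, 1) + cnj (M $$ (1, 1)) = - 2 * a"
    "M $$ (0, 1) + cnj (M $$ (1, 0)) = 0"
    using Mentry[of 0 0] Mentry[of 1 1] Mentry[of 0 1] lt[of 0] lt[of 1] A(1) by (simp_all add: two_level_entry)
  have Ynz: "\<not> (Y $$ (0, 0) = 0 \<and> Y $$ (0, 1) = 0 \<and> Y $$ (1, 0) = 0 \<and> Y $$ (1, 1) = 0)"
  proof
    assume z: "Y $$ (0, 0) = 0 \<and> Y $$ (0, 1) = 0 \<and> Y $$ (1, 0) = 0 \<and> Y $$ (1, 1) = 0"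
    have "Y $$ (i, j) = 0" if "i < n" "j < n" for i j
    proof (cases "i < 2 \<and> j < 2")
      case True
      then show ?thesis using z by (auto simp: less_2_cases_iff)
    next
      case False
      then show ?thesis using corner2D[OF Y(2,1) that] by auto
    qed
    then have "Y = 0\<^sub>m n n" using Y(1) by (intro eq_matI) auto
    then show False using Y(3) by simp
  qed
  have "P $$ (i, j) = (if i = j then 1 else 0)" if "i < 2" "j < 2" for i j
  proof -
    \<comment> \<open>the \<open>j\<close>-th column of \<open>1 - P\<close>, of which only the first two entries meet \<open>Y\<close>\<close>
    define z where "z k = (if k = j then 1 else 0) - P $$ (k, j)" for k
    have r: "Y $$ (k, 0) * z 0 + Y $$ (k, 1) * z 1 = 0" if k: "k < 2" for k
    proof -
      have "Y $$ (k, 0) * P $$ (0, j) + Y $$ (k, 1) * P $$ (1, j) = Y $$ (k, j)"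
        using mult_mat_entry[OF Y(1) P(1), of k j] YN[of k "\<lambda>l. P $$ (l, j)"] PY(2) k \<open>j < 2\<close> lt by simp
      then show ?thesis using \<open>j < 2\<close> by (auto simp: z_def algebra_simps less_2_cases_iff)
    qed
    have l: "cnj (z 0) * Y $$ (0, k) + cnj (z 1) * Y $$ (1, k) = 0" if k: "k < 2" for k
    proof -
      have "P $$ (j, 0) * Y $$ (0, k) + P $$ (j, 1) * Y $$ (1, k) = Y $$ (j, k)"
        using mult_mat_entry[OF P(1) Y(1), of j k] NY[of k "\<lambda>l. P $$ (j, l)"] PY(1) k \<open>j < 2\<close> lt by simp
      moreover have "cnj (P $$ (0, j)) = P $$ (j, 0)" "cnj (P $$ (1, j)) = P $$ (j, 1)"
        using hermitian_entry[OF P(1,3), of j 0] hermitian_entry[OF P(1,3), of j 1] \<open>j < 2\<close> lt by auto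
      ultimately show ?thesis using \<open>j < 2\<close> by (auto simp: z_def algebra_simps less_2_cases_iff)
    qed
    have "z 0 = 0 \<and> z 1 = 0"
      by (rule no_common_kernel_2x2[OF A(2) h(1,2,3) e[of 0 0] e[of 0 1] e[of 1 0] e[of 1 1]
            r[of 0] r[of 1] l[of 0] l[of 1] Ynz]) simp_all
    then show ?thesis using that by (auto simp: z_def less_2_cases_iff)
  qed
  then show ?thesis by (rule corner2_projection_support[OF n P _ B BP])
qed

text \<open>
If one of the Hermitian parts vanishes, an eigenbasis of the other one does it. Otherwise the eigenbasis of
\<open>A\<close> serves for both.
\<close>

theorem maximal_commutator_corner:
  assumes n: "n \<ge> 2" and X: "X \<in> carrier_mat n n" "X \<noteq> 0\<^sub>m n n"
    and Y: "Y \<in> carrier_mat n n" "frob_sq Y = 1"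
    and eq: "frob_sq (commutator X Y) = 2 * frob_sq X"
  shows "\<exists>U. unitary_mat n U \<and> corner2 (unitary_conj U X) \<and> mat_trace X = 0"
proof -
  obtain A B where A: "A \<in> carrier_mat n n" "mat_adjoint A = A" and B: "B \<in> carrier_mat n n" "mat_adjoint B = B"
    and XAB: "X = A + \<i> \<cdot>\<^sub>m B" using cartesian_decomposition[OF X(1)] by metis
  have Y0: "Y \<noteq> 0\<^sub>m n n" using Y frob_sq_eq_zero_iff[OF Y(1)] by auto
  note bw = boettcher_wenzel(2)[OF n A B Y, folded XAB, OF eq]
  have anti: "(A - \<i> \<cdot>\<^sub>m B) * Y + Y * (A - \<i> \<cdot>\<^sub>m B) = 0\<^sub>m n n"
    using bw adjoint_cartesian[OF A(1) B(1) A(2) B(2)] by (simp add: XAB)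
  have dich: "H = 0\<^sub>m n n \<or> (\<exists>U a. unitary_mat n U \<and> a \<noteq> 0 \<and> unitary_conj U H = two_level n a \<and> corner2 (unitary_conj U Y))"
    if "H \<in> carrier_mat n n" "mat_adjoint H = H"
      "2 * frob_sq H - (2 * Re (mat_trace (H * H * sym_gram Y)) - (Re (mat_trace (H * sym_gram Y)))\<^sup>2) = 0" for H
  proof -
    have "2 * Re (mat_trace (H * H * sym_gram Y)) - (Re (mat_trace (H * sym_gram Y)))\<^sup>2 = 2 * frob_sq H"
      using that(3) by simp
    from hermitian_variance(2)[OF n that(1,2) Y this] show ?thesis by blast
  qed
  have dA: "A = 0\<^sub>m n n \<or> (\<exists>U a. unitary_mat n U \<and> a \<noteq> 0 \<and> unitary_conj U A = two_level n a \<and> corner2 (unitary_conj U Y))"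
    using dich[OF A] bw by blast
  have dB: "B = 0\<^sub>m n n \<or> (\<exists>U a. unitary_mat n U \<and> a \<noteq> 0 \<and> unitary_conj U B = two_level n a \<and> corner2 (unitary_conj U Y))"
    using dich[OF B] bw by blast
  have tr: "mat_trace H = 0" if "H \<in> carrier_mat n n" "H = 0\<^sub>m n n \<or> (\<exists>U a. unitary_mat n U \<and> a \<noteq> 0 \<and> unitary_conj U H = two_level n a \<and> corner2 (unitary_conj U Y))" for H
    using that(2) unitary_conj_trace[OF _ that(1)] mat_trace_two_level[OF n] by (auto simp: mat_trace_def) metis
  have trX: "mat_trace X = 0"
    using tr[OF A(1) dA] tr[OF B(1) dB] A B by (simp add: XAB mat_trace_add[of _ n] mat_trace_smult[of _ n])
  have zero: "corner2 (unitary_conj U (0\<^sub>m n n))" if "unitary_mat n U" for U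
    using that unitary_conj_eq_zero_iff[of n U "0\<^sub>m n n"] by (simp add: corner2_def)
  have "\<exists>U. unitary_mat n U \<and> corner2 (unitary_conj U A) \<and> corner2 (unitary_conj U B)"
  proof (cases "A = 0\<^sub>m n n \<or> B = 0\<^sub>m n n")
    case True
    have one: "unitary_mat n (1\<^sub>m n)" by (simp add: unitary_mat_def)
    from True show ?thesis
    proof
      assume "A = 0\<^sub>m n n"
      with dB show ?thesis using zero one corner2_two_level by fastforce
    next
      assume "B = 0\<^sub>m n n"
      with dA show ?thesis using zero one corner2_two_level by fastforce
    qed
  next
    case False
    then obtain U a where U: "unitary_mat n U" "a \<noteq> 0" "unitary_conj U A = two_level n a" "corner2 (unitary_conj U Y)"
      using dA by blast
    obtain V b where V: "unitary_mat n V" "unitary_conj V B = two_level n b" "corner2 (unitary_conj V Y)"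
      using False dB by blast
    obtain P where P: "P \<in> carrier_mat n n" "P * P = P" "mat_adjoint P = P" "mat_trace P = 2"
        "P * Y = Y" "Y * P = Y" "B * P = B"
      using two_level_support_projection[OF n V(1) B(1) Y(1) V(2,3)] by metis
    let ?c = "unitary_conj U"
    have mult: "?c M * ?c N = ?c (M * N)" if "M \<in> carrier_mat n n" "N \<in> carrier_mat n n" for M N
      using unitary_conj_mult[OF U(1) that] by simp
    have minus: "?c A - \<i> \<cdot>\<^sub>m ?c B = ?c (A - \<i> \<cdot>\<^sub>m B)"
      using A B U(1) by (simp add: unitary_conj_minus unitary_conj_smult)
    have "(?c A - \<i> \<cdot>\<^sub>m ?c B) * ?c Y + ?c Y * (?c A - \<i> \<cdot>\<^sub>m ?c B) = 0\<^sub>m n n"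
    proof -
      have "(?c A - \<i> \<cdot>\<^sub>m ?c B) * ?c Y + ?c Y * (?c A - \<i> \<cdot>\<^sub>m ?c B)
          = ?c ((A - \<i> \<cdot>\<^sub>m B) * Y + Y * (A - \<i> \<cdot>\<^sub>m B))"
        unfolding minus using A B Y U(1) by (simp add: mult unitary_conj_add)
      then show ?thesis unfolding anti using U(1) unitary_conj_eq_zero_iff[OF U(1), of "0\<^sub>m n n"] by simp
    qed
    moreover have "mat_adjoint (?c B) = ?c B" "mat_adjoint (?c P) = ?c P"
      using unitary_conj_adjoint[OF U(1) B(1)] unitary_conj_adjoint[OF U(1) P(1)] B(2) P(3) by simp_all
    moreover have "?c P * ?c P = ?c P" "?c P * ?c Y = ?c Y" "?c Y * ?c P = ?c Y" "?c B * ?c P = ?c B"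
      using mult[OF P(1) P(1)] mult[OF P(1) Y(1)] mult[OF Y(1) P(1)] mult[OF B(1) P(1)] P by simp_all
    moreover have "mat_trace (?c P) = 2" using unitary_conj_trace[OF U(1) P(1)] P(4) by simp
    moreover have "?c Y \<noteq> 0\<^sub>m n n" using unitary_conj_eq_zero_iff[OF U(1) Y(1)] Y0 by simp
    ultimately have "corner2 (?c B)"
      using extremal_parts_share_corner[OF n U(3,2) unitary_conj_carrier[OF U(1) B(1)] _
          unitary_conj_carrier[OF U(1) Y(1)] U(4) _ _ unitary_conj_carrier[OF U(1) P(1)]] by blast
    moreover have "corner2 (?c A)" using U(3) corner2_two_level by simp
    ultimately show ?thesis using U(1) by blast
  qed
  then obtain U where U: "unitary_mat n U" "corner2 (unitary_conj U A)" "corner2 (unitary_conj U B)" by blast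
  have carr: "unitary_conj U A \<in> carrier_mat n n" "unitary_conj U B \<in> carrier_mat n n" using U A B by simp_all
  have "unitary_conj U X = unitary_conj U A + \<i> \<cdot>\<^sub>m unitary_conj U B"
    using U A B by (simp add: XAB unitary_conj_add unitary_conj_smult)
  then have "corner2 (unitary_conj U X)" using U(2,3) carr by (simp add: corner2_def)
  then show ?thesis using U(1) trX by blast
qed

section \<open>Eigenvalues of the double commutator\<close>

text \<open>
Listing the entries of \<open>Y\<close> row by row, with \<open>(k, l)\<close> at position \<open>k * n + l\<close>, turns \<open>F\<close> into a matrix of
order \<open>n\<^sup>2\<close> with the same eigenvalues.
\<close>

lemma finite_map_eigenvalues_of_coefficients:
  fixes K :: "nat \<Rightarrow> nat \<Rightarrow> nat \<Rightarrow> nat \<Rightarrow> complex"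
  assumes F: "\<And>Y i j. Y \<in> carrier_mat n n \<Longrightarrow> i < n \<Longrightarrow> j < n \<Longrightarrow>
      F Y $$ (i, j) = (\<Sum>k<n. \<Sum>l<n. K i j k l * Y $$ (k, l))"
  shows "finite {c. map_eigenvalue n F c}"
proof -
  define M where "M = mat (n * n) (n * n) (\<lambda>(r, s). K (r div n) (r mod n) (s div n) (s mod n))"
  have M: "M \<in> carrier_mat (n * n) (n * n)" by (simp add: M_def)
  have "eigenvalue M c" if ev: "map_eigenvalue n F c" for c
  proof -
    obtain Y where Y: "Y \<in> carrier_mat n n" "Y \<noteq> 0\<^sub>m n n" "F Y = c \<cdot>\<^sub>m Y"
      using ev by (auto simp: map_eigenvalue_def)
    define v where "v = vec (n * n) (\<lambda>s. Y $$ (s div n, s mod n))"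
    have v: "v \<in> carrier_vec (n * n)" by (simp add: v_def)
    have dm: "r div n < n \<and> r mod n < n" if "r < n * n" for r
      using that by (metis less_mult_imp_div_less mod_less_divisor mult_is_0 not_gr_zero not_less_zero)
    have reindex: "(\<Sum>s<n * n. f (s div n) (s mod n)) = (\<Sum>k<n. \<Sum>l<n. f k l)" for f :: "nat \<Rightarrow> nat \<Rightarrow> complex"
    proof -
      have "(\<Sum>s<n * n. f (s div n) (s mod n)) = (\<Sum>(k, l)\<in>{..<n} \<times> {..<n}. f k l)"
      proof (rule sum.reindex_bij_witness[of _ "\<lambda>(k, l). k * n + l" "\<lambda>s. (s div n, s mod n)"])
        fix b assume "b \<in> {..<n} \<times> {..<n}"
        then obtain k l where b: "b = (k, l)" "k < n" "l < n" by auto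
        have "k * n + l < Suc k * n" using b by simp
        also have "\<dots> \<le> n * n" using b by (intro mult_right_mono) auto
        finally show "(case b of (k, l) \<Rightarrow> k * n + l) \<in> {..<n * n}" using b by simp
      qed (use dm in auto)
      then show ?thesis by (simp add: sum.cartesian_product)
    qed
    have "M *\<^sub>v v = c \<cdot>\<^sub>v v"
    proof (rule eq_vecI)
      fix r assume "r < dim_vec (c \<cdot>\<^sub>v v)"
      then have r: "r < n * n" by (simp add: v_def)
      have "(M *\<^sub>v v) $ r = (\<Sum>s<n * n. K (r div n) (r mod n) (s div n) (s mod n) * Y $$ (s div n, s mod n))"
        using r by (auto simp: M_def v_def scalar_prod_def atLeast0LessThan)
      also have "\<dots> = F Y $$ (r div n, r mod n)"
        using F[OF Y(1)] dm[OF r] reindex[of "\<lambda>k l. K (r div n) (r mod n) k l * Y $$ (k, l)"] by simp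
      also have "\<dots> = (c \<cdot>\<^sub>v v) $ r" using Y dm[OF r] r by (simp add: v_def)
      finally show "(M *\<^sub>v v) $ r = (c \<cdot>\<^sub>v v) $ r" .
    qed (simp add: M_def v_def)
    moreover have "v \<noteq> 0\<^sub>v (n * n)"
    proof
      assume v0: "v = 0\<^sub>v (n * n)"
      have "Y $$ (k, l) = 0" if "k < n" "l < n" for k l
      proof -
        have "k * n + l < Suc k * n" using that by simp
        also have "\<dots> \<le> n * n" using that by (intro mult_right_mono) auto
        finally have lt: "k * n + l < n * n" .
        then have "v $ (k * n + l) = Y $$ (k, l)" using that by (simp add: v_def)
        moreover have "v $ (k * n + l) = 0" using lt unfolding v0 by simp
        ultimately show ?thesis by simp
      qed
      then show False using Y(1,2) by (auto intro: eq_matI)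
    qed
    ultimately show ?thesis using v M by (auto simp: eigenvalue_def eigenvector_def)
  qed
  then have "{c. map_eigenvalue n F c} \<subseteq> spectrum M" by (auto simp: spectrum_def)
  then show ?thesis using card_finite_spectrum(1)[OF M] finite_subset by blast
qed

text \<open>
This exhibits the coefficients of \<open>T\<^sub>X\<close> as a linear map in the entries of \<open>Y\<close>, from which the finiteness of
its set of eigenvalues follows; the four summands are those of
\<open>X\<^sup>*X Y - X\<^sup>* Y X - X Y X\<^sup>* + Y X X\<^sup>*\<close>.
\<close>

lemma T_map_entry:
  assumes X: "X \<in> carrier_mat n n" and Y: "Y \<in> carrier_mat n n" and ij: "i < n" "j < n"
  defines "F \<equiv> mat_adjoint X"
  shows "T_map X Y $$ (i, j) = (\<Sum>k<n. \<Sum>l<n. ((if l = j then (F * X) $$ (i, k) else 0) - F $$ (i, k) * X $$ (l, j)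
     - X $$ (i, k) * F $$ (l, j) + (if k = i then (X * F) $$ (l, j) else 0)) * Y $$ (k, l))"
proof -
  have F: "F \<in> carrier_mat n n" using X by (simp add: F_def)
  have T: "T_map X Y = (F * X) * Y - F * (Y * X) - (X * (Y * F) - Y * (X * F))"
    using X Y F by (simp add: T_map_def commutator_def F_def[symmetric] mult_minus_distrib_mat[of _ n n _ n]
        minus_mult_distrib_mat[of _ n n _ _ n] assoc_mult_mat[of _ n n _ n _ n])
  have e1: "((F * X) * Y) $$ (i, j) = (\<Sum>k<n. \<Sum>l<n. (if l = j then (F * X) $$ (i, k) else 0) * Y $$ (k, l))"
  proof -
    have "((F * X) * Y) $$ (i, j) = (\<Sum>k<n. (F * X) $$ (i, k) * Y $$ (k, j))"
      using X F Y ij by (intro mult_mat_entry) auto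
    also have "\<dots> = (\<Sum>k<n. \<Sum>l<n. (if l = j then (F * X) $$ (i, k) else 0) * Y $$ (k, l))"
      using ij by (intro sum.cong refl) (simp add: if_distrib[of "\<lambda>x. x * _"] sum.delta cong: if_cong)
    finally show ?thesis .
  qed
  have mid: "(P * (Y * Q)) $$ (i, j) = (\<Sum>k<n. \<Sum>l<n. (P $$ (i, k) * Q $$ (l, j)) * Y $$ (k, l))"
    if "P \<in> carrier_mat n n" "Q \<in> carrier_mat n n" for P Q
  proof -
    have "(P * (Y * Q)) $$ (i, j) = (\<Sum>k<n. P $$ (i, k) * (Y * Q) $$ (k, j))"
      using that Y ij by (intro mult_mat_entry) auto
    also have "\<dots> = (\<Sum>k<n. P $$ (i, k) * (\<Sum>l<n. Y $$ (k, l) * Q $$ (l, j)))"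
      using ij by (intro sum.cong refl) (simp add: mult_mat_entry[OF Y that(2)] del: index_mult_mat(1))
    finally show ?thesis by (simp add: sum_distrib_left mult_ac)
  qed
  have e4: "(Y * (X * F)) $$ (i, j) = (\<Sum>k<n. \<Sum>l<n. (if k = i then (X * F) $$ (l, j) else 0) * Y $$ (k, l))"
  proof -
    have "(Y * (X * F)) $$ (i, j) = (\<Sum>l<n. Y $$ (i, l) * (X * F) $$ (l, j))"
      using X F Y ij by (intro mult_mat_entry) auto
    also have "\<dots> = (\<Sum>l<n. \<Sum>k<n. (if k = i then (X * F) $$ (l, j) else 0) * Y $$ (k, l))"
    proof (intro sum.cong refl)
      fix l
      have "(\<Sum>k<n. (if k = i then (X * F) $$ (l, j) else 0) * Y $$ (k, l))
          = (\<Sum>k<n. if k = i then (X * F) $$ (l, j) * Y $$ (k, l) else 0)"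
        by (intro sum.cong) auto
      then show "Y $$ (i, l) * (X * F) $$ (l, j) = (\<Sum>k<n. (if k = i then (X * F) $$ (l, j) else 0) * Y $$ (k, l))"
        using ij by (simp add: mult.commute)
    qed
    finally show ?thesis by (subst sum.swap)
  qed
  have "T_map X Y $$ (i, j) = ((F * X) * Y) $$ (i, j) - (F * (Y * X)) $$ (i, j)
      - ((X * (Y * F)) $$ (i, j) - (Y * (X * F)) $$ (i, j))"
    unfolding T using X Y F ij by (simp del: index_mult_mat(1) assoc_mult_mat)
  also have "\<dots> = (\<Sum>k<n. \<Sum>l<n. ((if l = j then (F * X) $$ (i, k) else 0) - F $$ (i, k) * X $$ (l, j)
     - X $$ (i, k) * F $$ (l, j) + (if k = i then (X * F) $$ (l, j) else 0)) * Y $$ (k, l))"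
  proof -
    have "(\<Sum>k<n. \<Sum>l<n. a k l * y k l) - (\<Sum>k<n. \<Sum>l<n. b k l * y k l)
        - ((\<Sum>k<n. \<Sum>l<n. c k l * y k l) - (\<Sum>k<n. \<Sum>l<n. d k l * y k l))
        = (\<Sum>k<n. \<Sum>l<n. (a k l - b k l - c k l + d k l) * y k l)" for a b c d y :: "nat \<Rightarrow> nat \<Rightarrow> complex"
      by (simp add: algebra_simps sum_subtractf sum.distrib)
    then show ?thesis unfolding e1 e4 mid[OF F X] mid[OF X F] .
  qed
  finally show ?thesis .
qed

lemma finite_T_map_eigenvalues:
  assumes "X \<in> carrier_mat n n"
  shows "finite {c. map_eigenvalue n (T_map X) c}"
  by (rule finite_map_eigenvalues_of_coefficients[OF T_map_entry[OF assms]])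

lemma commutator_smult:
  assumes "X \<in> carrier_mat n n" "Y \<in> carrier_mat n n"
  shows "commutator X (c \<cdot>\<^sub>m Y) = c \<cdot>\<^sub>m commutator X Y"
  using assms by (simp add: commutator_def mult_smult_distrib[of _ n n _ n] mult_smult_assoc_mat[of _ n n _ n]
      smult_minus_distrib_mat[of _ n])

lemma T_map_smult:
  assumes "X \<in> carrier_mat n n" "Y \<in> carrier_mat n n"
  shows "T_map X (c \<cdot>\<^sub>m Y) = c \<cdot>\<^sub>m T_map X Y"
  using assms by (simp add: T_map_def commutator_smult[of _ n])

lemma T_map_inner:
  assumes X: "X \<in> carrier_mat n n" and Y: "Y \<in> carrier_mat n n"
  shows "mat_trace (T_map X Y * mat_adjoint Y) = of_real (frob_sq (commutator X Y))"
proof -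
  define F G Z where "F = mat_adjoint X" and "G = mat_adjoint Y" and "Z = commutator X Y"
  have c: "F \<in> carrier_mat n n" "G \<in> carrier_mat n n" "Z \<in> carrier_mat n n"
    using X Y by (simp_all add: F_def G_def Z_def)
  have Zadj: "mat_adjoint Z = G * F - F * G"
    using X Y by (simp add: Z_def commutator_def F_def G_def mat_adjoint_minus[of _ n n] mat_adjoint_mult[of _ n n _ n])
  have "mat_trace (T_map X Y * G) = mat_trace (F * (Z * G)) - mat_trace (Z * (F * G))"
    using c unfolding T_map_def F_def[symmetric] Z_def[symmetric] commutator_def[of F Z]
    by (simp add: minus_mult_distrib_mat[of _ n n _ _ n] mat_trace_minus[of _ n] assoc_mult_mat[of _ n n _ n _ n])
  also have "mat_trace (F * (Z * G)) = mat_trace (Z * (G * F))"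
    using mat_trace_comm[of F n n "Z * G"] c by (simp add: assoc_mult_mat[of _ n n _ n _ n])
  also have "mat_trace (Z * (G * F)) - mat_trace (Z * (F * G)) = mat_trace (Z * mat_adjoint Z)"
    unfolding Zadj using c by (simp add: mult_minus_distrib_mat[of _ n n _ n] mat_trace_minus[of _ n])
  finally show ?thesis using c by (simp add: frob_sq_trace[of _ n n] G_def Z_def)
qed

lemma T_map_eigenvalue_unit_vector:
  assumes X: "X \<in> carrier_mat n n" and ev: "map_eigenvalue n (T_map X) (complex_of_real l)"
  obtains Y where "Y \<in> carrier_mat n n" "frob_sq Y = 1" "frob_sq (commutator X Y) = l"
proof -
  obtain Z where Z: "Z \<in> carrier_mat n n" "Z \<noteq> 0\<^sub>m n n" "T_map X Z = complex_of_real l \<cdot>\<^sub>m Z"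
    using ev by (auto simp: map_eigenvalue_def)
  have pos: "frob_sq Z > 0" using Z frob_sq_eq_zero_iff[OF Z(1)] frob_sq_nonneg[of Z] by linarith
  define c where "c = complex_of_real (1 / sqrt (frob_sq Z))"
  define Y where "Y = c \<cdot>\<^sub>m Z"
  have Y: "Y \<in> carrier_mat n n" "frob_sq Y = 1"
    using Z pos by (simp_all add: Y_def frob_sq_smult c_def power_divide norm_divide)
  have "T_map X Y = complex_of_real l \<cdot>\<^sub>m Y"
    using X Z by (simp add: Y_def T_map_smult[of _ n] smult_smult_mat mult.commute)
  then have "complex_of_real (frob_sq (commutator X Y)) = complex_of_real l"
    using T_map_inner[OF X Y(1)] Y frob_sq_trace[OF Y(1)]
    by (simp add: mult_smult_assoc_mat[of _ n n _ n] mat_trace_smult[of _ n])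
  then show ?thesis using that Y by simp
qed

section \<open>Traceless blocks of order two\<close>

definition corner_embed :: "nat \<Rightarrow> complex mat \<Rightarrow> complex mat" where
  "corner_embed n M = diag_block_mat [M, 0\<^sub>m (n - 2) (n - 2)]"

lemma corner_embed_eq:
  "M \<in> carrier_mat 2 2 \<Longrightarrow>
    corner_embed n M = four_block_mat M (0\<^sub>m 2 (n - 2)) (0\<^sub>m (n - 2) 2) (0\<^sub>m (n - 2) (n - 2))"
  by (simp add: corner_embed_def Let_def)

lemma corner_embed_carrier [simp]:
  "n \<ge> 2 \<Longrightarrow> M \<in> carrier_mat 2 2 \<Longrightarrow> corner_embed n M \<in> carrier_mat n n"
  by (auto simp: corner_embed_eq)

lemma corner_embed_dim [simp]:
  assumes "n \<ge> 2" "M \<in> carrier_mat 2 2"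
  shows "dim_row (corner_embed n M) = n" "dim_col (corner_embed n M) = n"
  using corner_embed_carrier[OF assms] by (blast dest: carrier_matD)+

lemma corner_embed_entry:
  "n \<ge> 2 \<Longrightarrow> M \<in> carrier_mat 2 2 \<Longrightarrow> i < n \<Longrightarrow> j < n \<Longrightarrow>
    corner_embed n M $$ (i, j) = (if i < 2 \<and> j < 2 then M $$ (i, j) else 0)"
  by (auto simp: corner_embed_eq)

lemma corner_embed_mult:
  assumes "n \<ge> 2" "M \<in> carrier_mat 2 2" "N \<in> carrier_mat 2 2"
  shows "corner_embed n (M * N) = corner_embed n M * corner_embed n N"
  using assms
  by (simp add: corner_embed_eq mult_four_block_mat[of _ 2 2 _ "n - 2" _ "n - 2" _ _ 2 _ "n - 2"])

lemma corner_embed_minus: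
  assumes "n \<ge> 2" "M \<in> carrier_mat 2 2" "N \<in> carrier_mat 2 2"
  shows "corner_embed n (M - N) = corner_embed n M - corner_embed n N"
  using assms 
  by (intro eq_matI) (auto simp: corner_embed_entry)

lemma corner_embed_smult:
  assumes "n \<ge> 2" "M \<in> carrier_mat 2 2"
  shows "corner_embed n (c \<cdot>\<^sub>m M) = c \<cdot>\<^sub>m corner_embed n M"
  using assms
  by (intro eq_matI) (auto simp: corner_embed_entry)

lemma corner_embed_adjoint:
  assumes "n \<ge> 2" "M \<in> carrier_mat 2 2"
  shows "corner_embed n (mat_adjoint M) = mat_adjoint (corner_embed n M)"
  using assms
  by (intro eq_matI) (auto simp: corner_embed_entry mat_adjoint_entry)

lemma corner_embed_eq_zeroD:
  assumes "n \<ge> 2" "M \<in> carrier_mat 2 2" "corner_embed n M = 0\<^sub>m n n"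
  shows "M = 0\<^sub>m 2 2"
proof (rule eq_matI)
  fix i j assume "i < dim_row (0\<^sub>m 2 2 :: complex mat)" "j < dim_col (0\<^sub>m 2 2 :: complex mat)"
  then have "i < 2" "j < 2" by auto
  then show "M $$ (i, j) = 0\<^sub>m 2 2 $$ (i, j)"
    using corner_embed_entry[OF assms(1,2), of i j] assms(1,3) by simp
qed (use assms in auto)

lemma mat_trace_corner_embed:
  assumes "n \<ge> 2" "M \<in> carrier_mat 2 2"
  shows "mat_trace (corner_embed n M) = mat_trace M"
  using assms by (auto simp: mat_trace_def corner_embed_entry intro!: sum.mono_neutral_cong_right split: if_splits)

lemma frob_sq_corner_embed:
  assumes "n \<ge> 2" "M \<in> carrier_mat 2 2"
  shows "frob_sq (corner_embed n M) = frob_sq M"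
proof -
  have "complex_of_real (frob_sq (corner_embed n M)) = mat_trace (corner_embed n (M * mat_adjoint M))"
    using assms by (simp add: frob_sq_trace[of _ n n, symmetric] corner_embed_mult corner_embed_adjoint)
  also have "\<dots> = of_real (frob_sq M)"
    using assms by (simp add: mat_trace_corner_embed frob_sq_trace)
  finally show ?thesis by simp
qed

lemma T_map_corner_embed:
  assumes "n \<ge> 2" "M \<in> carrier_mat 2 2" "N \<in> carrier_mat 2 2"
  shows "T_map (corner_embed n M) (corner_embed n N) = corner_embed n (T_map M N)"
  using assms
  by (simp add: T_map_def commutator_def corner_embed_minus corner_embed_mult corner_embed_adjoint)

lemma T_map_unitary_conj:
  assumes "unitary_mat n U" "M \<in> carrier_mat n n" "N \<in> carrier_mat n n"
  shows "T_map (unitary_conj U M) (unitary_conj U N) = unitary_conj U (T_map M N)"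
  using assms
  by (simp add: T_map_def commutator_def unitary_conj_minus unitary_conj_mult unitary_conj_adjoint)

lemma lessThan_2: "{..<2::nat} = {0, 1}" by auto

text \<open>
Under the identification of traceless matrices of order two with three-dimensional vectors the commutator
is a multiple of the cross product, and this is the expansion of a triple cross product.
\<close>

lemma T_map_traceless_2x2:
  assumes X: "X \<in> carrier_mat 2 2" "mat_trace X = 0" and Y: "Y \<in> carrier_mat 2 2" "mat_trace Y = 0"
  shows "T_map X Y = (2 * complex_of_real (frob_sq X)) \<cdot>\<^sub>m Y - (2 * mat_trace (Y * mat_adjoint X)) \<cdot>\<^sub>m X"
proof -
  have tX: "X $$ (1, 1) = - X $$ (0, 0)" and tY: "Y $$ (1, 1) = - Y $$ (0, 0)"
    using X Y by (auto simp: mat_trace_def lessThan_2 add_eq_0_iff)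
  have T: "T_map X Y \<in> carrier_mat 2 2" using X Y by (simp add: T_map_def)
  have fX: "complex_of_real (frob_sq X) = mat_trace (X * mat_adjoint X)" using X by (simp add: frob_sq_trace)
  have entry: "(M * N) $$ (i, j) = M $$ (i, 0) * N $$ (0, j) + M $$ (i, 1) * N $$ (1, j)"
    if "M \<in> carrier_mat 2 2" "N \<in> carrier_mat 2 2" "i < 2" "j < 2" for M N :: "complex mat" and i j
    using mult_mat_entry[OF that] by (simp add: lessThan_2)
  have bracket: "commutator M N $$ (0, 0) = M $$ (0, 1) * N $$ (1, 0) - N $$ (0, 1) * M $$ (1, 0)"
      "commutator M N $$ (0, 1) = 2 * (M $$ (0, 0) * N $$ (0, 1) - N $$ (0, 0) * M $$ (0, 1))"
      "commutator M N $$ (1, 0) = 2 * (M $$ (1, 0) * N $$ (0, 0) - N $$ (1, 0) * M $$ (0, 0))"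
      "commutator M N $$ (1, 1) = - (M $$ (0, 1) * N $$ (1, 0) - N $$ (0, 1) * M $$ (1, 0))"
    if "M \<in> carrier_mat 2 2" "N \<in> carrier_mat 2 2" "M $$ (1, 1) = - M $$ (0, 0)" "N $$ (1, 1) = - N $$ (0, 0)"
    for M N :: "complex mat"
  proof -
    have "commutator M N $$ (i, j) = (M $$ (i, 0) * N $$ (0, j) + M $$ (i, 1) * N $$ (1, j))
        - (N $$ (i, 0) * M $$ (0, j) + N $$ (i, 1) * M $$ (1, j))" if "i < 2" "j < 2" for i j
    proof -
      have "commutator M N $$ (i, j) = (M * N) $$ (i, j) - (N * M) $$ (i, j)"
        using \<open>M \<in> _\<close> \<open>N \<in> _\<close> that unfolding commutator_def by (intro index_minus_mat) auto
      then show ?thesis using entry \<open>M \<in> _\<close> \<open>N \<in> _\<close> that by (simp only:)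
    qed
    note this[of 0 0, simplified, folded One_nat_def] this[of 0 1, simplified, folded One_nat_def]
      this[of 1 0, simplified, folded One_nat_def] this[of 1 1, simplified, folded One_nat_def]
    then show "commutator M N $$ (0, 0) = M $$ (0, 1) * N $$ (1, 0) - N $$ (0, 1) * M $$ (1, 0)"
      "commutator M N $$ (0, 1) = 2 * (M $$ (0, 0) * N $$ (0, 1) - N $$ (0, 0) * M $$ (0, 1))"
      "commutator M N $$ (1, 0) = 2 * (M $$ (1, 0) * N $$ (0, 0) - N $$ (1, 0) * M $$ (0, 0))"
      "commutator M N $$ (1, 1) = - (M $$ (0, 1) * N $$ (1, 0) - N $$ (0, 1) * M $$ (1, 0))"
      using that(3,4) by (simp_all add: algebra_simps del: One_nat_def)
  qed
  have adj: "mat_adjoint X $$ (0, 0) = cnj (X $$ (0, 0))" "mat_adjoint X $$ (0, 1) = cnj (X $$ (1, 0))"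
      "mat_adjoint X $$ (1, 0) = cnj (X $$ (0, 1))" "mat_adjoint X $$ (1, 1) = - cnj (X $$ (0, 0))"
    using X(1) tX by (simp_all add: mat_adjoint_entry del: One_nat_def)
  have Z: "commutator X Y \<in> carrier_mat 2 2" using X Y by simp
  note inner = bracket[OF X(1) Y(1) tX tY]
  have F: "mat_adjoint X \<in> carrier_mat 2 2" using X by simp
  have "commutator X Y $$ (1, 1) = - commutator X Y $$ (0, 0)" by (simp only: inner)
  then have outer: "commutator (mat_adjoint X) (commutator X Y) $$ (0, 0) = mat_adjoint X $$ (0, 1) * commutator X Y $$ (1, 0) - commutator X Y $$ (0, 1) * mat_adjoint X $$ (1, 0)"
      "commutator (mat_adjoint X) (commutator X Y) $$ (0, 1) = 2 * (mat_adjoint X $$ (0, 0) * commutator X Y $$ (0, 1) - commutator X Y $$ (0, 0) * mat_adjoint X $$ (0, 1))"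
      "commutator (mat_adjoint X) (commutator X Y) $$ (1, 0) = 2 * (mat_adjoint X $$ (1, 0) * commutator X Y $$ (0, 0) - commutator X Y $$ (1, 0) * mat_adjoint X $$ (0, 0))"
      "commutator (mat_adjoint X) (commutator X Y) $$ (1, 1) = - (mat_adjoint X $$ (0, 1) * commutator X Y $$ (1, 0) - commutator X Y $$ (0, 1) * mat_adjoint X $$ (1, 0))"
    using adj by (intro bracket[OF F Z]; simp only:)+
  have trace: "mat_trace (M * mat_adjoint X) = M $$ (0, 0) * cnj (X $$ (0, 0)) + M $$ (0, 1) * cnj (X $$ (0, 1))
      + M $$ (1, 0) * cnj (X $$ (1, 0)) - M $$ (1, 1) * cnj (X $$ (0, 0))" if "M \<in> carrier_mat 2 2" for M
    using that X(1) adj by (simp add: mat_trace_mult[of _ 2 2] lessThan_2 del: One_nat_def)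
  note trace = trace[OF X(1)] trace[OF Y(1)]
  show ?thesis
  proof (rule eq_matI)
    fix i j
    assume "i < dim_row ((2 * complex_of_real (frob_sq X)) \<cdot>\<^sub>m Y - (2 * mat_trace (Y * mat_adjoint X)) \<cdot>\<^sub>m X)"
      "j < dim_col ((2 * complex_of_real (frob_sq X)) \<cdot>\<^sub>m Y - (2 * mat_trace (Y * mat_adjoint X)) \<cdot>\<^sub>m X)"
    then have ij: "i < 2" "j < 2" using X by auto
    have "T_map X Y $$ (i, j) = 2 * mat_trace (X * mat_adjoint X) * Y $$ (i, j) - 2 * mat_trace (Y * mat_adjoint X) * X $$ (i, j)"
      using ij unfolding less_2_cases_iff One_nat_def[symmetric] trace T_map_def
      by (elim disjE; hypsubst; simp only: outer inner adj tX tY; simp add: algebra_simps del: One_nat_def)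
    then show "T_map X Y $$ (i, j) =
        ((2 * complex_of_real (frob_sq X)) \<cdot>\<^sub>m Y - (2 * mat_trace (Y * mat_adjoint X)) \<cdot>\<^sub>m X) $$ (i, j)"
      using ij X Y by (simp add: fX)
  qed (use X Y T in auto)
qed

text \<open>
Among the matrices with zero diagonal, which are traceless, one is orthogonal to \<open>X\<close>: this is one linear
equation in two unknowns.
\<close>

lemma traceless_2x2_eigenvector:
  assumes X: "X \<in> carrier_mat 2 2" "mat_trace X = 0" "frob_sq X = 1"
  shows "\<exists>Y \<in> carrier_mat 2 2. Y \<noteq> 0\<^sub>m 2 2 \<and> T_map X Y = 2 \<cdot>\<^sub>m Y"
proof -
  define q r where "q = cnj (X $$ (0, 1))" and "r = cnj (X $$ (1, 0))"
  obtain s t where st: "s * q + t * r = 0" "s \<noteq> 0 \<or> t \<noteq> 0"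
  proof (cases "q = 0 \<and> r = 0")
    case True
    then show ?thesis using that[of 1 0] by simp
  next
    case False
    then show ?thesis using that[of r "- q"] by auto
  qed
  define Y where "Y = mat 2 2 (\<lambda>(i, j). if i = 0 \<and> j = 1 then s else if i = 1 \<and> j = 0 then t else 0)"
  have Y: "Y \<in> carrier_mat 2 2" by (simp add: Y_def)
  have trY: "mat_trace Y = 0" by (simp add: mat_trace_def Y_def lessThan_2)
  have ip: "mat_trace (Y * mat_adjoint X) = 0"
    using X Y st(1) by (simp add: mat_trace_mult[of _ 2 2] lessThan_2 mat_adjoint_entry Y_def q_def r_def add.commute)
  have "Y $$ (0, 1) = s" "Y $$ (1, 0) = t" by (simp_all add: Y_def)
  then have "Y \<noteq> 0\<^sub>m 2 2" using st(2) by auto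
  moreover have "T_map X Y = 2 \<cdot>\<^sub>m Y"
    using T_map_traceless_2x2[OF X(1,2) Y trY] X Y ip by (auto intro!: eq_matI)
  ultimately show ?thesis using Y by blast
qed

lemma corner2_imp_corner_embed:
  assumes n: "n \<ge> 2" and M: "M \<in> carrier_mat n n" "corner2 M"
  shows "M = corner_embed n (mat 2 2 (\<lambda>ij. M $$ ij))"
  using M n
  by (intro eq_matI) (auto simp: corner_embed_entry corner2_def)

theorem theorem3p2:
  fixes n :: nat and X :: "complex mat"
  assumes "n \<ge> 2"
    and "X \<in> carrier_mat n n"
    and "frobenius_norm X = 1"
  shows "largest_eigenvalue n (T_map X) = 2 \<longleftrightarrow>
    (\<exists>U X0. unitary_mat n U \<and> X0 \<in> carrier_mat 2 2 \<and> mat_trace X0 = 0 \<and>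
       X = U * diag_block_mat [X0, 0\<^sub>m (n - 2) (n - 2)] * mat_adjoint U)"
proof -
  note n = assms(1) and X = assms(2)
  have fX: "frob_sq X = 1" using assms(3) by (simp add: frobenius_norm_eq_sqrt)
  define E where "E = {l. map_eigenvalue n (T_map X) (complex_of_real l)}"
  have "complex_of_real ` E \<subseteq> {c. map_eigenvalue n (T_map X) c}" by (auto simp: E_def)
  then have fin: "finite E"
    using finite_T_map_eigenvalues[OF X] by (meson finite_imageD finite_subset inj_on_def of_real_eq_iff)
  have le2: "l \<le> 2" if l: "l \<in> E" for l
  proof -
    obtain Y where Y: "Y \<in> carrier_mat n n" "frob_sq Y = 1" "frob_sq (commutator X Y) = l"
      using T_map_eigenvalue_unit_vector[OF X] l unfolding E_def by blast
    obtain A B where A: "A \<in> carrier_mat n n" "mat_adjoint A = A" and B: "B \<in> carrier_mat n n" "mat_adjoint B = B"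
      and XAB: "X = A + \<i> \<cdot>\<^sub>m B" using cartesian_decomposition[OF X] by metis
    show ?thesis using boettcher_wenzel(1)[OF n A B Y(1,2), folded XAB] Y(3) fX by simp
  qed
  \<comment> \<open>The identity matrix is an eigenvector for 0, so \<open>E\<close> is nonempty and \<open>Max E\<close> is one of its elements.\<close>
  have "commutator X (1\<^sub>m n) = 0\<^sub>m n n" using X by (simp add: commutator_def minus_r_inv_mat)
  then have "T_map X (1\<^sub>m n) = 0\<^sub>m n n"
    using X by (simp add: T_map_def commutator_def minus_r_inv_mat[of _ n n])
  also have "0\<^sub>m n n = complex_of_real 0 \<cdot>\<^sub>m 1\<^sub>m n" by (intro eq_matI) auto
  finally have "T_map X (1\<^sub>m n) = complex_of_real 0 \<cdot>\<^sub>m 1\<^sub>m n" .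
  moreover have "1\<^sub>m n \<noteq> (0\<^sub>m n n :: complex mat)"
  proof
    assume "1\<^sub>m n = (0\<^sub>m n n :: complex mat)"
    then have "1\<^sub>m n $$ (0, 0) = (0\<^sub>m n n :: complex mat) $$ (0, 0)" by simp
    then show False using n by simp
  qed
  ultimately have ne: "0 \<in> E"
    unfolding E_def map_eigenvalue_def mem_Collect_eq by (intro bexI[of _ "1\<^sub>m n"] conjI) simp_all
  have Max2: "largest_eigenvalue n (T_map X) = 2 \<longleftrightarrow> 2 \<in> E"
  proof
    assume "largest_eigenvalue n (T_map X) = 2"
    then have "Max E = 2" by (simp add: largest_eigenvalue_def E_def)
    moreover have "Max E \<in> E" using fin ne by (intro Max_in) auto
    ultimately show "2 \<in> E" by simp
  next
    assume "2 \<in> E"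
    then have "Max E = 2" using fin le2 by (intro Max_eqI)
    then show "largest_eigenvalue n (T_map X) = 2" by (simp add: largest_eigenvalue_def E_def)
  qed
  show ?thesis unfolding Max2 corner_embed_def[symmetric]
  proof
    assume "2 \<in> E"
    then obtain Y where Y: "Y \<in> carrier_mat n n" "frob_sq Y = 1" "frob_sq (commutator X Y) = 2"
      using T_map_eigenvalue_unit_vector[OF X] unfolding E_def by blast
    have X0: "X \<noteq> 0\<^sub>m n n" using fX frob_sq_eq_zero_iff[OF X] by auto
    obtain U where U: "unitary_mat n U" "corner2 (unitary_conj U X)" "mat_trace X = 0"
      using maximal_commutator_corner[OF n X X0 Y(1,2)] Y(3) fX by auto
    define X0 where "X0 = mat 2 2 (\<lambda>ij. unitary_conj U X $$ ij)"
    have X0: "X0 \<in> carrier_mat 2 2" by (simp add: X0_def)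
    have emb: "unitary_conj U X = corner_embed n X0"
      using corner2_imp_corner_embed[OF n _ U(2)] U(1) X by (simp add: X0_def)
    have "mat_trace X0 = 0"
      using mat_trace_corner_embed[OF n X0] unitary_conj_trace[OF U(1) X] U(3) by (simp add: emb)
    moreover have "X = U * corner_embed n X0 * mat_adjoint U"
      using unitary_conj_cancel[OF U(1) X] by (simp add: emb)
    ultimately show "\<exists>U X0. unitary_mat n U \<and> X0 \<in> carrier_mat 2 2 \<and> mat_trace X0 = 0 \<and>
       X = U * corner_embed n X0 * mat_adjoint U" using U(1) X0 by blast
  next
    assume "\<exists>U X0. unitary_mat n U \<and> X0 \<in> carrier_mat 2 2 \<and> mat_trace X0 = 0 \<and>
       X = U * corner_embed n X0 * mat_adjoint U"
    then obtain U X0 where U: "unitary_mat n U" and X0: "X0 \<in> carrier_mat 2 2" "mat_trace X0 = 0"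
      and XU: "X = unitary_conj (mat_adjoint U) (corner_embed n X0)"
      by (auto simp: unitary_conj_def)
    let ?V = "mat_adjoint U"
    have V: "unitary_mat n ?V" using U by (rule unitary_mat_adjoint)
    have "frob_sq X0 = 1"
      using fX n X0 by (simp add: XU unitary_conj_frob_sq[OF V] frob_sq_corner_embed)
    then obtain Y0 where Y0: "Y0 \<in> carrier_mat 2 2" "Y0 \<noteq> 0\<^sub>m 2 2" "T_map X0 Y0 = 2 \<cdot>\<^sub>m Y0"
      using traceless_2x2_eigenvector[OF X0] by blast
    define Y where "Y = unitary_conj ?V (corner_embed n Y0)"
    have emb: "corner_embed n X0 \<in> carrier_mat n n" "corner_embed n Y0 \<in> carrier_mat n n"
      using n X0 Y0 by simp_all
    have "Y \<in> carrier_mat n n" using V emb by (simp add: Y_def)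
    moreover have "Y \<noteq> 0\<^sub>m n n"
      using unitary_conj_eq_zero_iff[OF V emb(2)] corner_embed_eq_zeroD[OF n Y0(1)] Y0(2) by (auto simp: Y_def)
    moreover have "T_map X Y = complex_of_real 2 \<cdot>\<^sub>m Y"
      using V emb n X0 Y0
      by (simp add: XU Y_def T_map_unitary_conj T_map_corner_embed corner_embed_smult unitary_conj_smult)
    ultimately show "2 \<in> E" unfolding E_def map_eigenvalue_def by blast
  qed
qed

end
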